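(* Let $A=(A_0,A_1,A_2,A_3)$ be generic complex parameters. The solution $f^{(0,0)}(A;x)$ of $Z(A)$ holomorphic at $x=0$, normalized by $f^{(0,0)}(A;0)=1$, can be expressed as \begin{align*} f^{(0,0)}(A;x)&=\sum_{n=0}^\infty x^n\,\frac{(A_{----})_n(A_{--++})_n}{n!\,(\frac32-A_0)_n}\;{}_4F_3\!\left(\begin{matrix}-n,\ A_0-n,\ A_{-+-+},\ A_{-++-}\\ A_{++--}-n,\ A_{++++}-n,\ 1-A_0\end{matrix};1\right)\\ &=\sum_{n=0}^\infty x^n\,\frac{(1-A_0-A_2)_n(A_{--+-})_n(A_{--++})_n}{n!\,(1-A_0)_n(\frac32-A_0)_n}\;{}_4F_3\!\left(\begin{matrix}-n,\ A_0-A_2-n,\ A_{-+-+},\ A_{-+--}\\ A_{++--}-n,\ A_{++-+}-n,\ 1-A_0-A_2\end{matrix};1\right). \end{align*} It is invariant under $A_j\to-A_j$ ($j=1,2,3$) and under $A_2\leftrightarrow A_3$.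
   Context: Notation: $A_{\varepsilon_0\varepsilon_1\varepsilon_2\varepsilon_3}=(\varepsilon_0A_0+\varepsilon_1A_1+\varepsilon_2A_2+\varepsilon_3A_3+1)/2$ for signs $\varepsilon_j=\pm$; $(a)_n=a(a+1)\cdots(a+n-1)$; ${}_4F_3$ is the generalized hypergeometric series. Generic means outside a countable union of proper algebraic hypersurfaces of the parameter space. With $\partial=d/dx$, $Z(A)=p_0\partial^4+p_1\partial^3+p_2\partial^2+p_3\partial+p_4$, where \begin{align*} p_0&=x^3(x-1)^2,\qquad p_1=-2x^2(x-1)(2A_0x-2A_0-5x+3),\\ p_2&=x\big[(6A_0^2-A_2^2-A_3^2-24A_0+25)x^2+(-11A_0^2-A_1^2+A_2^2+A_3^2+36A_0-\tfrac{59}2)x+\tfrac14(10A_0-9)(2A_0-3)\big],\\ p_3&=-(2A_0-3)(2A_0^2-A_2^2-A_3^2-6A_0+5)x^2+(A_0-1)(6A_0^2+2A_1^2-2A_2^2-2A_3^2-16A_0+11)x-\tfrac14(2A_0-3)(2A_0-1)^2,\\ p_4&=(A_0-1+A_3)(A_0-1-A_3)(A_0-1+A_2)(A_0-1-A_2)\,x-\tfrac14(2A_0-1)^2(A_0^2+A_1^2-A_2^2-A_3^2-2A_0+1). \end{align*} Its local exponents at $x=0$ are $0,\ A_0-\frac12,\ A_0+\frac12,\ 2A_0$. *)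

theory Defs
  imports "HOL-Analysis.Analysis"
begin

text \<open>
  A hypersurface of affine space is the zero set of a nonconstant polynomial, written here as
  a finite linear combination of monomials, a monomial being given by its exponent vector.
\<close>

definition algebraic_hypersurface :: "(complex ^ 'n) set \<Rightarrow> bool" where
  "algebraic_hypersurface V \<longleftrightarrow>
     (\<exists>M c. finite M \<and> (\<exists>m\<in>M. m \<noteq> (\<lambda>_. 0) \<and> c m \<noteq> 0) \<and>
        V = {z. (\<Sum>m\<in>M. c m * (\<Prod>i\<in>UNIV. (z $ i) ^ (m i :: nat))) = 0})"

definition holds_generically :: "(complex ^ 'n \<Rightarrow> bool) \<Rightarrow> bool" where
  "holds_generically P \<longleftrightarrow>
     (\<exists>\<V>. countable \<V> \<and> (\<forall>V\<in>\<V>. algebraic_hypersurface V) \<and> (\<forall>A. A \<notin> \<Union>\<V> \<longrightarrow> P A))"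

text \<open>
  The parameter vector is \<open>A :: complex ^ 4\<close> with components \<open>A $ 0, A $ 1, A $ 2, A $ 3\<close>.
  These are the four components since the index type \<open>4\<close> is the type of integers modulo 4.
\<close>

definition Zop :: "complex ^ 4 \<Rightarrow> (complex \<Rightarrow> complex) \<Rightarrow> complex \<Rightarrow> complex" where
  "Zop A f x =
    (let A0 = A $ 0; A1 = A $ 1; A2 = A $ 2; A3 = A $ 3;
         p0 = x^3 * (x - 1)^2;
         p1 = - 2 * x^2 * (x - 1) * (2*A0*x - 2*A0 - 5*x + 3);
         p2 = x * ((6*A0^2 - A2^2 - A3^2 - 24*A0 + 25) * x^2
                   + (- 11*A0^2 - A1^2 + A2^2 + A3^2 + 36*A0 - 59/2) * x
                   + 1/4 * (10*A0 - 9) * (2*A0 - 3));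
         p3 = - (2*A0 - 3) * (2*A0^2 - A2^2 - A3^2 - 6*A0 + 5) * x^2
              + (A0 - 1) * (6*A0^2 + 2*A1^2 - 2*A2^2 - 2*A3^2 - 16*A0 + 11) * x
              - 1/4 * (2*A0 - 3) * (2*A0 - 1)^2;
         p4 = (A0 - 1 + A3) * (A0 - 1 - A3) * (A0 - 1 + A2) * (A0 - 1 - A2) * x
              - 1/4 * (2*A0 - 1)^2 * (A0^2 + A1^2 - A2^2 - A3^2 - 2*A0 + 1)
     in p0 * (deriv ^^ 4) f x + p1 * (deriv ^^ 3) f x + p2 * (deriv ^^ 2) f x
        + p3 * deriv f x + p4 * f x)"

definition normalized_solution :: "complex ^ 4 \<Rightarrow> real \<Rightarrow> (complex \<Rightarrow> complex) \<Rightarrow> bool" where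
  "normalized_solution A r f \<longleftrightarrow>
     f holomorphic_on ball 0 r \<and> (\<forall>x\<in>ball 0 r. Zop A f x = 0) \<and> f 0 = 1"

text \<open>
  The equation is singular only at 0, 1 and infinity, so the solution holomorphic at 0 lives on
  the open unit disc. The value 0 outside the disc only serves to single out one total function.
\<close>

definition f00 :: "complex ^ 4 \<Rightarrow> complex \<Rightarrow> complex" where
  "f00 A = (THE f. normalized_solution A 1 f \<and> (\<forall>x. x \<notin> ball 0 1 \<longrightarrow> f x = 0))"

definition Asgn :: "complex ^ 4 \<Rightarrow> complex \<Rightarrow> complex \<Rightarrow> complex \<Rightarrow> complex \<Rightarrow> complex" where
  "Asgn A e0 e1 e2 e3 = (e0 * A $ 0 + e1 * A $ 1 + e2 * A $ 2 + e3 * A $ 3 + 1) / 2"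

text \<open>
  The generalized hypergeometric series; \<open>fps_hypergeo as bs 1\<close> has the coefficients
  \<open>(\<Prod>a. (a)\<^sub>n) / ((\<Prod>b. (b)\<^sub>n) n!)\<close>. Below it is used only with an upper parameter \<open>-n\<close>,
  so that it terminates.
\<close>

definition hypergeometric :: "complex list \<Rightarrow> complex list \<Rightarrow> complex \<Rightarrow> complex" where
  "hypergeometric as bs z = eval_fps (fps_hypergeo as bs 1) z"

definition f00_coeff1 :: "complex ^ 4 \<Rightarrow> nat \<Rightarrow> complex" where
  "f00_coeff1 A n =
     pochhammer (Asgn A (-1) (-1) (-1) (-1)) n * pochhammer (Asgn A (-1) (-1) 1 1) n
     / (fact n * pochhammer (3/2 - A $ 0) n)
     * hypergeometric
         [- of_nat n, A $ 0 - of_nat n, Asgn A (-1) 1 (-1) 1, Asgn A (-1) 1 1 (-1)]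
         [Asgn A 1 1 (-1) (-1) - of_nat n, Asgn A 1 1 1 1 - of_nat n, 1 - A $ 0] 1"

definition f00_coeff2 :: "complex ^ 4 \<Rightarrow> nat \<Rightarrow> complex" where
  "f00_coeff2 A n =
     pochhammer (1 - A $ 0 - A $ 2) n * pochhammer (Asgn A (-1) (-1) 1 (-1)) n
     * pochhammer (Asgn A (-1) (-1) 1 1) n
     / (fact n * pochhammer (1 - A $ 0) n * pochhammer (3/2 - A $ 0) n)
     * hypergeometric
         [- of_nat n, A $ 0 - A $ 2 - of_nat n, Asgn A (-1) 1 (-1) 1, Asgn A (-1) 1 (-1) (-1)]
         [Asgn A 1 1 (-1) (-1) - of_nat n, Asgn A 1 1 (-1) 1 - of_nat n, 1 - A $ 0 - A $ 2] 1"

definition negate_component :: "4 \<Rightarrow> complex ^ 4 \<Rightarrow> complex ^ 4" where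
  "negate_component j A = (\<chi> i. if i = j then - A $ i else A $ i)"

definition swap23 :: "complex ^ 4 \<Rightarrow> complex ^ 4" where
  "swap23 A = (\<chi> i. if i = 2 then A $ 3 else if i = 3 then A $ 2 else A $ i)"

end

theory Submission
  imports Defs "HOL-Complex_Analysis.Complex_Analysis"
begin

text \<open>
  Reflecting the Pochhammer symbols \<open>(1 - a - n)\<^sub>k = (-1)\<^sup>k (a)\<^sub>n / (a)\<^sub>n\<^sub>-\<^sub>k\<close> turns both \<open>4F3\<close>
  sums into a factor \<open>(p)\<^sub>n (q)\<^sub>n / ((e)\<^sub>n (e + 1/2)\<^sub>n)\<close>, with \<open>e = 1 - A\<^sub>0\<close>, times the \<open>n\<close>-th coefficient
  of a product \<open>F(a, b; q; x) F(c, d; p; x)\<close> of two Gauss series with \<open>a + b + c + d = p + q = 2e\<close>.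
  The coefficients of any such product with \<open>a + b + c + d = p + q\<close> satisfy a three-term recurrence,
  and for both choices of parameters it becomes the coefficient recurrence of \<open>Z(A)\<close>.
  The latter has a unique solution with given initial value as long as the exponents of
  \<open>Z(A)\<close> at \<open>0\<close> other than \<open>0\<close> are not positive integers, so both sums agree. The product has
  radius of convergence at least 1 and the factor is bounded for \<open>p = q = e\<close>. The symmetries are those of \<open>Z(A)\<close>, whose
  coefficients involve only \<open>A\<^sub>1\<^sup>2\<close>, \<open>A\<^sub>2\<^sup>2 + A\<^sub>3\<^sup>2\<close> and \<open>A\<^sub>2\<^sup>2 A\<^sub>3\<^sup>2\<close>.
\<close>

no_notation fps_nth (infixl \<open>$\<close> 75)

section \<open>Coefficients of products of two Gauss series\<close>

text \<open>The weight takes the index of \<open>v\<close> as a complex number, so that weights can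
  be handled as polynomials in \<open>k\<close> and shifted by 1. The constant weight 1 gives the
  coefficients of the product of the two series.\<close>

definition weighted_conv :: "(nat \<Rightarrow> complex) \<Rightarrow> (nat \<Rightarrow> complex) \<Rightarrow> (complex \<Rightarrow> complex) \<Rightarrow> nat \<Rightarrow> complex" where
  "weighted_conv u v \<phi> N = (\<Sum>k\<le>N. \<phi> (of_nat k) * (u (N - k) * v k))"

text \<open>The factor \<open>(of_nat N + 1 - k) * (q + of_nat N - k)\<close> is the left factor of
  the recurrence of \<open>u\<close> at \<open>i = N - k\<close>, so it lowers the index of
  \<open>u\<close> by 1. It vanishes at \<open>k = Suc N\<close>, hence no boundary term
  remains.\<close>

lemma weighted_conv_shift_left:
  assumes u: "\<And>i. of_nat (Suc i) * (q + of_nat i) * u (Suc i) = (a + of_nat i) * (b + of_nat i) * u i"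
  shows "weighted_conv u v (\<lambda>k. (of_nat N + 1 - k) * (q + of_nat N - k) * \<phi> k) (Suc N) =
         weighted_conv u v (\<lambda>k. (a + of_nat N - k) * (b + of_nat N - k) * \<phi> k) N"
  unfolding weighted_conv_def sum.atMost_Suc
proof -
  have "(of_nat N + 1 - of_nat k) * (q + of_nat N - of_nat k) * \<phi> (of_nat k) * (u (Suc N - k) * v k)
      = (a + of_nat N - of_nat k) * (b + of_nat N - of_nat k) * \<phi> (of_nat k) * (u (N - k) * v k)"
    if "k \<le> N" for k
  proof -
    have "(of_nat N + 1 - of_nat k) * (q + of_nat N - of_nat k) * u (Suc N - k) =
          (a + of_nat N - of_nat k) * (b + of_nat N - of_nat k) * u (N - k)"
      using u[of "N - k"] that by (simp add: Suc_diff_le of_nat_diff algebra_simps)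
    then have "\<phi> (of_nat k) * ((of_nat N + 1 - of_nat k) * (q + of_nat N - of_nat k) * u (Suc N - k)) * v k =
          \<phi> (of_nat k) * ((a + of_nat N - of_nat k) * (b + of_nat N - of_nat k) * u (N - k)) * v k"
      by simp
    then show ?thesis by (simp only: mult_ac)
  qed
  then have "(\<Sum>k\<le>N. (of_nat N + 1 - of_nat k) * (q + of_nat N - of_nat k) * \<phi> (of_nat k) * (u (Suc N - k) * v k))
      = (\<Sum>k\<le>N. (a + of_nat N - of_nat k) * (b + of_nat N - of_nat k) * \<phi> (of_nat k) * (u (N - k) * v k))"
    by (intro sum.cong) auto
  then show "(\<Sum>k\<le>N. (of_nat N + 1 - of_nat k) * (q + of_nat N - of_nat k) * \<phi> (of_nat k) * (u (Suc N - k) * v k))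
      + (of_nat N + 1 - of_nat (Suc N)) * (q + of_nat N - of_nat (Suc N)) * \<phi> (of_nat (Suc N)) * (u (Suc N - Suc N) * v (Suc N))
      = (\<Sum>k\<le>N. (a + of_nat N - of_nat k) * (b + of_nat N - of_nat k) * \<phi> (of_nat k) * (u (N - k) * v k))"
    by simp
qed

text \<open>The factor \<open>k * (p + k - 1)\<close> is the left factor of the recurrence of
  \<open>v\<close> at \<open>i = k - 1\<close>. It vanishes at \<open>k = 0\<close>, and reindexing
  the other terms turns \<open>\<phi> k\<close> into \<open>\<phi> (k + 1)\<close>.\<close>

lemma weighted_conv_shift_right:
  assumes v: "\<And>i. of_nat (Suc i) * (p + of_nat i) * v (Suc i) = (c + of_nat i) * (d + of_nat i) * v i"
  shows "weighted_conv u v (\<lambda>k. k * (p + k - 1) * \<phi> k) (Suc N) =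
         weighted_conv u v (\<lambda>k. (c + k) * (d + k) * \<phi> (k + 1)) N"
proof -
  have "weighted_conv u v (\<lambda>k. k * (p + k - 1) * \<phi> k) (Suc N) =
     (\<Sum>k\<le>N. of_nat (Suc k) * (p + of_nat (Suc k) - 1) * \<phi> (of_nat (Suc k)) * (u (Suc N - Suc k) * v (Suc k)))"
    unfolding weighted_conv_def by (subst sum.atMost_Suc_shift) simp
  also have "\<dots> = weighted_conv u v (\<lambda>k. (c + k) * (d + k) * \<phi> (k + 1)) N"
    unfolding weighted_conv_def
  proof (rule sum.cong)
    fix k
    have "of_nat (Suc k) * (p + of_nat (Suc k) - 1) * v (Suc k) = (c + of_nat k) * (d + of_nat k) * v k"
      using v[of k] by (simp add: algebra_simps)
    then have "\<phi> (of_nat k + 1) * u (N - k) * (of_nat (Suc k) * (p + of_nat (Suc k) - 1) * v (Suc k))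
        = \<phi> (of_nat k + 1) * u (N - k) * ((c + of_nat k) * (d + of_nat k) * v k)"
      by simp
    moreover have "of_nat (Suc k) = (of_nat k + 1 :: complex)" by simp
    ultimately show "of_nat (Suc k) * (p + of_nat (Suc k) - 1) * \<phi> (of_nat (Suc k)) * (u (Suc N - Suc k) * v (Suc k))
      = (c + of_nat k) * (d + of_nat k) * \<phi> (of_nat k + 1) * (u (N - k) * v k)"
      by (simp only: mult_ac diff_Suc_Suc)
  qed simp
  finally show ?thesis .
qed

lemma weighted_conv_add:
  "weighted_conv u v (\<lambda>k. \<phi> k + \<psi> k) N = weighted_conv u v \<phi> N + weighted_conv u v \<psi> N"
  by (simp add: weighted_conv_def sum.distrib ring_distribs)

lemma weighted_conv_cmult:
  "weighted_conv u v (\<lambda>k. r * \<phi> k) N = r * weighted_conv u v \<phi> N"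
  by (simp add: weighted_conv_def sum_distrib_left mult_ac)

text \<open>
  The recurrence comes from writing a constant as a combination, with cofactors linear in \<open>k\<close>, of the
  two quadratic polynomials in \<open>k\<close> that the shift rules move between levels: at the upper level the
  constant is \<open>conv_up\<close>, at the lower level \<open>conv_down\<close> (both are resultants), and
  the two combinations meet at the middle level, where under the balancing condition their sum is
  independent of \<open>k\<close>.
\<close>

definition conv_up :: "complex \<Rightarrow> complex \<Rightarrow> complex \<Rightarrow> complex" where
  "conv_up p q n = n * (n + q - 1) * (n + p - 1) * (n + p + q - 2)"

definition conv_down :: "complex \<Rightarrow> complex \<Rightarrow> complex \<Rightarrow> complex \<Rightarrow> complex \<Rightarrow> complex" where
  "conv_down a b c d m = (a + c + m) * (a + d + m) * (b + c + m) * (b + d + m)"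

text \<open>This is the common weight of the middle level evaluated at \<open>k = 0\<close>:
  \<open>s * k + w\<close> and \<open>(s - 2) * k + z\<close> are the cofactors of the first
  quadratic in the relations to the upper and to the lower level.\<close>

definition conv_mid :: "complex \<Rightarrow> complex \<Rightarrow> complex \<Rightarrow> complex \<Rightarrow> complex \<Rightarrow> complex \<Rightarrow> complex \<Rightarrow> complex" where
  "conv_mid a b c d p q j =
    (let s = 2 * j + p + q;
         w = (j + 1) * (j + q) + s * (p - 1);
         z = (a + j - 1) * (b + j - 1) - c * d + (s - 2) * (c + d)
     in (s - 2) * ((a + j) * (b + j) * w + c * d * (s\<^sup>2 - s - w)) + s * j * (j + q - 1) * z)"

context
  fixes a b c d p q :: complex and u v :: "nat \<Rightarrow> complex"
  assumes u: "\<And>i. of_nat (Suc i) * (q + of_nat i) * u (Suc i) = (a + of_nat i) * (b + of_nat i) * u i"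
    and v: "\<And>i. of_nat (Suc i) * (p + of_nat i) * v (Suc i) = (c + of_nat i) * (d + of_nat i) * v i"
begin

text \<open>A Bezout identity in \<open>k\<close> for the quadratics with roots
  \<open>N + 1\<close>, \<open>q + N\<close> and \<open>0\<close>, \<open>1 - p\<close>, whose
  resultant is \<open>conv_up p q (of_nat N + 1)\<close>; \<open>s\<close> is the difference of the
  two root sums. Each summand then descends to level \<open>N\<close> by its own shift rule.\<close>

lemma conv_up_eq:
  fixes N :: nat
  defines "s \<equiv> 2 * of_nat N + p + q"
  defines "w \<equiv> (of_nat N + 1) * (of_nat N + q) + s * (p - 1)"
  shows "conv_up p q (of_nat N + 1) * weighted_conv u v (\<lambda>_. 1) (Suc N) =
    weighted_conv u v (\<lambda>k. (a + of_nat N - k) * (b + of_nat N - k) * (s * k + w)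
                          + (c + k) * (d + k) * (s\<^sup>2 - s * (k + 1) - w)) N"
proof -
  have "(of_nat N + 1 - k) * (q + of_nat N - k) * (s * k + w) + k * (p + k - 1) * (s\<^sup>2 - s * k - w)
     = conv_up p q (of_nat N + 1) * 1" for k
    unfolding conv_up_def w_def s_def by algebra
  then have "conv_up p q (of_nat N + 1) * weighted_conv u v (\<lambda>_. 1) (Suc N) =
    weighted_conv u v (\<lambda>k. (of_nat N + 1 - k) * (q + of_nat N - k) * (s * k + w)
        + k * (p + k - 1) * (s\<^sup>2 - s * k - w)) (Suc N)"
    by (simp only: weighted_conv_cmult)
  then show ?thesis
    by (simp only: weighted_conv_add weighted_conv_shift_left[where u=u, OF u] weighted_conv_shift_right[where v=v, OF v])
qed

text \<open>The same device in the opposite direction: the quadratics have roots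
  \<open>a + j - 1\<close>, \<open>b + j - 1\<close> and \<open>- c\<close>, \<open>- d\<close>, and
  the shift rules are read from right to left. Balancing makes the difference of the root sums equal
  to \<open>s - 2\<close>.\<close>

lemma conv_down_eq:
  fixes M :: nat
  defines "j \<equiv> of_nat (Suc M)"
  defines "s \<equiv> 2 * j + p + q"
  defines "z \<equiv> (a + j - 1) * (b + j - 1) - c * d + (s - 2) * (c + d)"
  assumes bal: "a + b + c + d = p + q"
  shows "conv_down a b c d (j - 1) * weighted_conv u v (\<lambda>_. 1) M =
    weighted_conv u v (\<lambda>k. (j - k) * (q + j - 1 - k) * ((s - 2) * k + z)
                          + k * (p + k - 1) * ((s - 2)\<^sup>2 + (s - 2) - (s - 2) * k - z)) (Suc M)"
proof -
  have j: "of_nat M + 1 = j" "q + of_nat M = q + j - 1" "a + of_nat M = a + j - 1" "b + of_nat M = b + j - 1"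
    by (simp_all add: j_def)
  note left = weighted_conv_shift_left[where u=u and q=q and a=a and b=b and N=M, OF u, unfolded j]
  have d: "d = p + q - a - b - c" using bal by algebra
  have "(a + j - 1 - k) * (b + j - 1 - k) * ((s - 2) * k + z)
       + (c + k) * (d + k) * ((s - 2)\<^sup>2 + (s - 2) - (s - 2) * (k + 1) - z)
     = conv_down a b c d (j - 1) * 1" for k
    unfolding conv_down_def z_def s_def d by algebra
  then have "conv_down a b c d (j - 1) * weighted_conv u v (\<lambda>_. 1) M =
    weighted_conv u v (\<lambda>k. (a + j - 1 - k) * (b + j - 1 - k) * ((s - 2) * k + z)
       + (c + k) * (d + k) * ((s - 2)\<^sup>2 + (s - 2) - (s - 2) * (k + 1) - z)) M"
    by (simp only: weighted_conv_cmult)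
  then show ?thesis
    by (simp only: weighted_conv_add left weighted_conv_shift_right[where v=v, OF v])
qed

text \<open>In each bracket the cubic terms in \<open>k\<close> cancel, and under balancing the
  quadratic coefficients are \<open>- s\<close> and \<open>s - 2\<close>. The multipliers
  \<open>s - 2\<close> and \<open>s\<close> remove these, and the linear terms cancel at the same
  time.\<close>

lemma conv_mid_eq:
  fixes j k :: complex
  defines "s \<equiv> 2 * j + p + q"
  defines "w \<equiv> (j + 1) * (j + q) + s * (p - 1)"
  defines "z \<equiv> (a + j - 1) * (b + j - 1) - c * d + (s - 2) * (c + d)"
  assumes bal: "a + b + c + d = p + q"
  shows "(s - 2) * ((a + j - k) * (b + j - k) * (s * k + w) + (c + k) * (d + k) * (s\<^sup>2 - s * (k + 1) - w))
     + s * ((j - k) * (q + j - 1 - k) * ((s - 2) * k + z) + k * (p + k - 1) * ((s - 2)\<^sup>2 + (s - 2) - (s - 2) * k - z))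
     = conv_mid a b c d p q j"
proof -
  have d: "d = p + q - a - b - c" using bal by algebra
  show ?thesis
    unfolding conv_mid_def Let_def s_def w_def z_def d by algebra
qed

lemma conv_rec:
  assumes bal: "a + b + c + d = p + q"
  defines "T \<equiv> weighted_conv u v (\<lambda>_. 1)"
  shows "(2 * of_nat N + p + q - 2) * (conv_up p q (of_nat N + 1) * T (Suc N))
     + (2 * of_nat N + p + q) * (if N = 0 then 0 else conv_down a b c d (of_nat N - 1) * T (N - 1))
     = conv_mid a b c d p q (of_nat N) * T N"
proof -
  define s where "s = 2 * of_nat N + p + q"
  define w where "w = (of_nat N + 1) * (of_nat N + q) + s * (p - 1)"
  define z where "z = (a + of_nat N - 1) * (b + of_nat N - 1) - c * d + (s - 2) * (c + d)"
  \<comment> \<open>The default value 0 is the right one at \<open>N = 0\<close>: the only term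
    there is \<open>k = 0\<close>, where the factors \<open>of_nat N - k\<close> and
    \<open>k\<close> both vanish.\<close>
  have down: "(if N = 0 then 0 else conv_down a b c d (of_nat N - 1) * T (N - 1)) =
     weighted_conv u v (\<lambda>k. (of_nat N - k) * (q + of_nat N - 1 - k) * ((s - 2) * k + z)
                          + k * (p + k - 1) * ((s - 2)\<^sup>2 + (s - 2) - (s - 2) * k - z)) N"
  proof (cases N)
    case 0
    then show ?thesis by (simp add: weighted_conv_def)
  next
    case (Suc M)
    show ?thesis
      using conv_down_eq[OF bal, of M] unfolding T_def z_def s_def Suc by simp
  qed
  have up: "conv_up p q (of_nat N + 1) * T (Suc N) =
     weighted_conv u v (\<lambda>k. (a + of_nat N - k) * (b + of_nat N - k) * (s * k + w)
                          + (c + k) * (d + k) * (s\<^sup>2 - s * (k + 1) - w)) N"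
    unfolding T_def conv_up_eq s_def w_def ..
  have "conv_mid a b c d p q (of_nat N) * T N = weighted_conv u v (\<lambda>k. conv_mid a b c d p q (of_nat N) * 1) N"
    unfolding T_def by (simp only: weighted_conv_cmult)
  also have "\<dots> = (s - 2) * (conv_up p q (of_nat N + 1) * T (Suc N)) + s * (if N = 0 then 0 else conv_down a b c d (of_nat N - 1) * T (N - 1))"
    unfolding down up weighted_conv_cmult[symmetric] weighted_conv_add[symmetric]
    using conv_mid_eq[OF bal, of "of_nat N"] unfolding s_def w_def z_def by simp
  finally show ?thesis by (simp add: s_def)
qed

end

section \<open>The coefficient recurrence of the operator\<close>

text \<open>\<open>Z(A)\<close> sends \<open>x^n\<close> to
  \<open>Z_up A n * x^(n-1) + Z_mid A n * x^n + Z_down A n * x^(n+1)\<close>. Thus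
  \<open>Z_up A\<close> is the indicial polynomial at 0, and the roots of \<open>Z_down A\<close>
  are the negatives of the exponents at infinity.\<close>

definition Z_up :: "complex ^ 4 \<Rightarrow> complex \<Rightarrow> complex" where
  "Z_up A n = n * (n - A $ 0 + 1/2) * (n - A $ 0 - 1/2) * (n - 2 * A $ 0)"

definition Z_mid :: "complex ^ 4 \<Rightarrow> complex \<Rightarrow> complex" where
  "Z_mid A n =
    (let A0 = A $ 0; A1 = A $ 1; A2 = A $ 2; A3 = A $ 3 in
     - 2 * (n * (n - 1) * (n - 2) * (n - 3)) + (8 * A0 - 16) * (n * (n - 1) * (n - 2))
     + (- 11*A0^2 - A1^2 + A2^2 + A3^2 + 36*A0 - 59/2) * (n * (n - 1))
     + (A0 - 1) * (6*A0^2 + 2*A1^2 - 2*A2^2 - 2*A3^2 - 16*A0 + 11) * n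
     - 1/4 * (2*A0 - 1)^2 * (A0^2 + A1^2 - A2^2 - A3^2 - 2*A0 + 1))"

definition Z_down :: "complex ^ 4 \<Rightarrow> complex \<Rightarrow> complex" where
  "Z_down A n =
    (n + 1 - A $ 0 + A $ 2) * (n + 1 - A $ 0 - A $ 2) * (n + 1 - A $ 0 + A $ 3) * (n + 1 - A $ 0 - A $ 3)"

text \<open>The coefficient of \<open>x^n\<close> in \<open>Z(A)\<close> applied to the power series
  with coefficients \<open>c\<close>.\<close>

definition Z_coeff :: "complex ^ 4 \<Rightarrow> (nat \<Rightarrow> complex) \<Rightarrow> nat \<Rightarrow> complex" where
  "Z_coeff A c n = Z_up A (of_nat n + 1) * c (Suc n) + Z_mid A (of_nat n) * c n
     + (if n = 0 then 0 else Z_down A (of_nat n - 1) * c (n - 1))"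

text \<open>The Pochhammer quotient trades the factors of \<open>conv_up\<close> that contain
  \<open>p\<close> or \<open>q\<close> alone for factors in \<open>e\<close>, which produces
  \<open>Z_up\<close>; \<open>down\<close> and \<open>mid\<close> are the corresponding conditions
  on the other two coefficients. Since \<open>p + q = 2 * e\<close>, the multipliers in
  \<open>conv_rec\<close> become \<open>2 * (e + n - 1)\<close> and
  \<open>2 * (e + n)\<close>.\<close>

lemma Z_coeff_conv_eq_0:
  fixes A :: "complex ^ 4"
  defines "e \<equiv> 1 - A $ 0"
  assumes u: "\<And>i. of_nat (Suc i) * (q + of_nat i) * u (Suc i) = (a + of_nat i) * (b + of_nat i) * u i"
    and v: "\<And>i. of_nat (Suc i) * (p + of_nat i) * v (Suc i) = (c + of_nat i) * (d + of_nat i) * v i"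
    and abcd: "a + b + c + d = p + q" and pq: "p + q = 2 * e"
    and down: "\<And>m. conv_down a b c d m * ((p + m) * (q + m)) = Z_down A m * (e + m)\<^sup>2"
    and mid: "\<And>j. 2 * (e + j) * (e + j - 1) * Z_mid A j = - (e + j - 1/2) * conv_mid a b c d p q j"
    and nz: "\<And>i. e + of_nat i \<noteq> 0" "\<And>i. e + 1/2 + of_nat i \<noteq> 0" "A $ 0 \<noteq> 0"
  shows "Z_coeff A (\<lambda>n. pochhammer p n * pochhammer q n / (pochhammer e n * pochhammer (e + 1/2) n)
            * weighted_conv u v (\<lambda>_. 1) n) n = 0"
proof -
  define T where "T = weighted_conv u v (\<lambda>_. 1)"
  define g where "g n = pochhammer p n * pochhammer q n / (pochhammer e n * pochhammer (e + 1/2) n)" for n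
  have A0: "A $ 0 = 1 - e" by (simp add: e_def)
  have g_Suc: "(e + of_nat n) * (e + 1/2 + of_nat n) * g (Suc n) = (p + of_nat n) * (q + of_nat n) * g n" for n
  proof -
    have "g (Suc n) = ((p + of_nat n) * (q + of_nat n)) / ((e + of_nat n) * (e + 1/2 + of_nat n)) * g n"
      by (simp add: g_def pochhammer_Suc mult_ac)
    then show ?thesis using nz(1,2)[of n] by simp
  qed
  note rec = conv_rec[where u=u and v=v, OF u v abcd, folded T_def, of n]
  have "Z_coeff A (\<lambda>n. g n * T n) n = 0"
  proof (cases n)
    case 0
    \<comment> \<open>At index 0 the equation is multiplied by \<open>2 * e * (e - 1)\<close>, whose
      last factor is \<open>- A $ 0\<close>.\<close>
    have e1: "e - 1 \<noteq> 0" "e \<noteq> 0" using nz(1)[of 0] nz(3) by (auto simp: A0)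
    have "p + q - 2 = 2 * (e - 1)" using pq by simp
    then have r: "2 * (e - 1) * (q * p * (2 * e - 1)) * T 1 = conv_mid a b c d p q 0 * T 0"
      using rec pq by (simp add: 0 conv_up_def algebra_simps)
    have m: "2 * e * (e - 1) * Z_mid A 0 = - (e - 1/2) * conv_mid a b c d p q 0"
      using mid[of 0] by simp
    have G: "e * (e + 1/2) * g 1 = p * q" using g_Suc[of 0] by (simp add: g_def)
    have zc: "Z_coeff A (\<lambda>n. g n * T n) 0 =
       (e + 1/2) * (e - 1/2) * (2 * e - 1) * (g 1 * T 1) + Z_mid A 0 * T 0"
    proof -
      have "g 0 = 1" by (simp add: g_def)
      then show ?thesis by (simp add: Z_coeff_def Z_up_def A0 algebra_simps)
    qed
    have "2 * e * (e - 1) * Z_coeff A (\<lambda>n. g n * T n) 0 =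
       2 * (e - 1) * (e * (e + 1/2) * g 1) * ((e - 1/2) * (2 * e - 1)) * T 1
       + (2 * e * (e - 1) * Z_mid A 0) * T 0"
      unfolding zc by algebra
    also have "\<dots> = (e - 1/2) * (2 * (e - 1) * (q * p * (2 * e - 1)) * T 1 - conv_mid a b c d p q 0 * T 0)"
      unfolding m G by algebra
    also have "\<dots> = 0" unfolding r by simp
    finally show ?thesis using e1 by (simp add: 0)
  next
    case (Suc M)
    define m :: complex where "m = of_nat M"
    have e1: "e + m \<noteq> 0" "e + m + 1 \<noteq> 0"
      using nz(1)[of M] nz(1)[of "Suc M"] by (simp_all add: m_def add_ac)
    have q: "q = 2 * e - p" using pq by algebra
    have r: "2 * (e + m) * (conv_up p q (m + 2) * T (Suc (Suc M)))
        + 2 * (e + m + 1) * (conv_down a b c d m * T M) = conv_mid a b c d p q (m + 1) * T (Suc M)"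
    proof -
      have n: "of_nat n + 1 = m + 2" "of_nat n - 1 = m" "of_nat n = m + 1"
        by (simp_all add: Suc m_def)
      have s1: "2 * of_nat n + p + q = 2 * (e + m + 1)"
        unfolding n q by algebra
      have s2: "2 * of_nat n + p + q - 2 = 2 * (e + m)"
        unfolding s1 by algebra
      show ?thesis
        using rec unfolding s2 unfolding s1 unfolding n by (simp add: Suc add_ac)
    qed
    have md: "2 * (e + m + 1) * (e + m) * Z_mid A (m + 1) = - (e + m + 1/2) * conv_mid a b c d p q (m + 1)"
      using mid[of "m + 1"] by (simp add: algebra_simps)
    have G1: "(e + m) * (e + m + 1/2) * g (Suc M) = (p + m) * (q + m) * g M"
      using g_Suc[of M] by (simp add: m_def algebra_simps)
    have G2: "(e + m + 1) * (e + m + 3/2) * g (Suc (Suc M)) = (p + m + 1) * (q + m + 1) * g (Suc M)"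
      using g_Suc[of "Suc M"] by (simp add: m_def algebra_simps)
    have zc: "Z_coeff A (\<lambda>n. g n * T n) (Suc M) =
       (m + 2) * (e + m + 3/2) * (e + m + 1/2) * (m + 2 * e) * (g (Suc (Suc M)) * T (Suc (Suc M)))
       + Z_mid A (m + 1) * (g (Suc M) * T (Suc M)) + Z_down A m * (g M * T M)"
      by (simp add: Z_coeff_def Z_up_def A0 m_def algebra_simps)
    \<comment> \<open>The multiplier is chosen so that \<open>G2\<close>, \<open>md\<close> and
      \<open>down\<close> each apply to one summand. Afterwards \<open>G1\<close> exposes the common
      factor \<open>(p + m) * (q + m) * g M\<close> in front of the convolution recurrence.\<close>
    have "2 * (e + m)\<^sup>2 * (e + m + 1) * Z_coeff A (\<lambda>n. g n * T n) (Suc M) =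
       2 * (e + m) * (m + 2) * (m + 2 * e) * (e + m) * (e + m + 1/2) *
         ((e + m + 1) * (e + m + 3/2) * g (Suc (Suc M))) * T (Suc (Suc M))
       + (2 * (e + m + 1) * (e + m) * Z_mid A (m + 1)) * (e + m) * (g (Suc M) * T (Suc M))
       + 2 * (e + m + 1) * (Z_down A m * (e + m)\<^sup>2) * (g M * T M)"
      unfolding zc by algebra
    also have "\<dots> = ((e + m) * (e + m + 1/2) * g (Suc M)) *
         (2 * (e + m) * (m + 2) * (m + 2 * e) * ((p + m + 1) * (q + m + 1)) * T (Suc (Suc M))
          - conv_mid a b c d p q (m + 1) * T (Suc M))
       + 2 * (e + m + 1) * (conv_down a b c d m * ((p + m) * (q + m))) * (g M * T M)"
      unfolding G2 md down by algebra
    also have "\<dots> = (p + m) * (q + m) * g M *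
       ((2 * (e + m) * (conv_up p q (m + 2) * T (Suc (Suc M)))
        + 2 * (e + m + 1) * (conv_down a b c d m * T M)) - conv_mid a b c d p q (m + 1) * T (Suc M))"
      unfolding G1 conv_up_def q by algebra
    also have "\<dots> = 0" unfolding r by simp
    finally show ?thesis using e1 by (simp add: Suc)
  qed
  then show ?thesis by (simp add: g_def T_def)
qed


text \<open>
  Here \<open>x, y, z\<close> stand for \<open>A\<^sub>1, A\<^sub>2, A\<^sub>3\<close>. Taking some of the \<open>a, b, c, d\<close> as independent
  variables makes all the others integer combinations, without the halves of \<open>Asgn\<close>.
\<close>

lemma conv_mid_first_scaled:
  fixes e a c d j :: complex
  defines "b \<equiv> 2 * e - a - c - d" and "x \<equiv> c + d - e" and "y \<equiv> e - a - c" and "z \<equiv> e - a - d"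
  shows "4 * (e + j) * (e + j - 1) *
    (- 8 * (j * (j - 1) * (j - 2) * (j - 3)) - (32 * e + 32) * (j * (j - 1) * (j - 2))
     + (- 44*(1-e)^2 - 4*x^2 + 4*y^2 + 4*z^2 + 26 - 144 * e) * (j * (j - 1))
     - 4 * e * (6*(1-e)^2 + 2*x^2 - 2*y^2 - 2*z^2 - 5 + 16*e) * j
     - (1 - 2 * e)^2 * (e^2 + x^2 - y^2 - z^2)) = - 4 * (2 * e + 2 * j - 1) * conv_mid a b c d e e j"
  unfolding conv_mid_def Let_def b_def x_def y_def z_def by algebra

lemma conv_mid_second_scaled:
  fixes e a y z j :: complex
  defines "c \<equiv> e - a" and "b \<equiv> a + z" and "d \<equiv> e - a - z" and "x \<equiv> e - 2 * a + y - z"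
  shows "4 * (e + j) * (e + j - 1) *
    (- 8 * (j * (j - 1) * (j - 2) * (j - 3)) - (32 * e + 32) * (j * (j - 1) * (j - 2))
     + (- 44*(1-e)^2 - 4*x^2 + 4*y^2 + 4*z^2 + 26 - 144 * e) * (j * (j - 1))
     - 4 * e * (6*(1-e)^2 + 2*x^2 - 2*y^2 - 2*z^2 - 5 + 16*e) * j
     - (1 - 2 * e)^2 * (e^2 + x^2 - y^2 - z^2)) = - 4 * (2 * e + 2 * j - 1) * conv_mid a b c d (e - y) (e + y) j"
  unfolding conv_mid_def Let_def b_def c_def d_def x_def by algebra

text \<open>The factor 4 clears the fractions of \<open>Z_mid\<close>, and substituting
  \<open>A $ 0 = 1 - e\<close> gives the polynomial shared by the two scaled identities
  above.\<close>

lemma Z_mid_scaled: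
  fixes A :: "complex ^ 4"
  defines "e \<equiv> 1 - A $ 0" and "x \<equiv> A $ 1" and "y \<equiv> A $ 2" and "z \<equiv> A $ 3"
  shows "4 * Z_mid A j =
    (- 8 * (j * (j - 1) * (j - 2) * (j - 3)) - (32 * e + 32) * (j * (j - 1) * (j - 2))
     + (- 44*(1-e)^2 - 4*x^2 + 4*y^2 + 4*z^2 + 26 - 144 * e) * (j * (j - 1))
     - 4 * e * (6*(1-e)^2 + 2*x^2 - 2*y^2 - 2*z^2 - 5 + 16*e) * j
     - (1 - 2 * e)^2 * (e^2 + x^2 - y^2 - z^2))"
proof -
  have A0: "A $ 0 = 1 - e" by (simp add: e_def)
  have p2: "4 * (- 11*(1-e)^2 - x^2 + y^2 + z^2 + 36*(1-e) - 59/2) = - 44*(1-e)^2 - 4*x^2 + 4*y^2 + 4*z^2 + 26 - 144 * e"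
    by (simp add: field_simps)
  have p4: "4 * (1/4 * (2*(1-e) - 1)^2 * ((1-e)^2 + x^2 - y^2 - z^2 - 2*(1-e) + 1)) = (1 - 2 * e)^2 * (e^2 + x^2 - y^2 - z^2)"
    by (simp add: power2_eq_square algebra_simps)
  \<comment> \<open>Distributing 4 over the outer summands only keeps intact the blocks that
    \<open>p2\<close> and \<open>p4\<close> rewrite.\<close>
  have distr: "4 * (t0 + t1 + t2 * r + t3 - t4) = 4 * t0 + 4 * t1 + (4 * t2) * r + 4 * t3 - 4 * t4"
    for t0 t1 t2 t3 t4 r :: complex
    by algebra
  show ?thesis
    unfolding Z_mid_def Let_def x_def[symmetric] y_def[symmetric] z_def[symmetric] A0 distr p2 p4 by algebra
qed

lemma conv_mid_first:
  fixes A :: "complex ^ 4"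
  defines "e \<equiv> 1 - A $ 0"
  shows "2 * (e + j) * (e + j - 1) * Z_mid A j = - (e + j - 1/2) *
    conv_mid (Asgn A (-1) (-1) (-1) (-1)) (Asgn A (-1) (-1) 1 1) (Asgn A (-1) 1 (-1) 1) (Asgn A (-1) 1 1 (-1)) e e j"
proof -
  define a b c d where "a = Asgn A (-1) (-1) (-1) (-1)" and "b = Asgn A (-1) (-1) 1 1"
    and "c = Asgn A (-1) 1 (-1) 1" and "d = Asgn A (-1) 1 1 (-1)"
  have lin: "b = 2 * e - a - c - d" "A $ 1 = c + d - e" "A $ 2 = e - a - c" "A $ 3 = e - a - d"
    by (simp_all add: a_def b_def c_def d_def e_def Asgn_def field_simps)
  have "4 * (e + j) * (e + j - 1) * (4 * Z_mid A j) = - 4 * (2 * e + 2 * j - 1) * conv_mid a b c d e e j"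
    unfolding Z_mid_scaled e_def[symmetric] lin by (rule conv_mid_first_scaled)
  then show ?thesis
    unfolding a_def[symmetric] b_def[symmetric] c_def[symmetric] d_def[symmetric] by algebra
qed

lemma conv_mid_second:
  fixes A :: "complex ^ 4"
  defines "e \<equiv> 1 - A $ 0"
  shows "2 * (e + j) * (e + j - 1) * Z_mid A j = - (e + j - 1/2) *
    conv_mid (Asgn A (-1) (-1) 1 (-1)) (Asgn A (-1) (-1) 1 1) (Asgn A (-1) 1 (-1) 1) (Asgn A (-1) 1 (-1) (-1))
      (e - A $ 2) (e + A $ 2) j"
proof -
  define a b c d where "a = Asgn A (-1) (-1) 1 (-1)" and "b = Asgn A (-1) (-1) 1 1"
    and "c = Asgn A (-1) 1 (-1) 1" and "d = Asgn A (-1) 1 (-1) (-1)"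
  have lin: "c = e - a" "b = a + A $ 3" "d = e - a - A $ 3" "A $ 1 = e - 2 * a + A $ 2 - A $ 3"
    by (simp_all add: a_def b_def c_def d_def e_def Asgn_def field_simps)
  have "4 * (e + j) * (e + j - 1) * (4 * Z_mid A j) =
      - 4 * (2 * e + 2 * j - 1) * conv_mid a b c d (e - A $ 2) (e + A $ 2) j"
    unfolding Z_mid_scaled e_def[symmetric] lin by (rule conv_mid_second_scaled)
  then show ?thesis
    unfolding a_def[symmetric] b_def[symmetric] c_def[symmetric] d_def[symmetric] by algebra
qed

text \<open>The sums of one of the first two parameters and one of the last two are
  \<open>e - A $ 2\<close>, \<open>e - A $ 3\<close>, \<open>e + A $ 3\<close> and
  \<open>e + A $ 2\<close>, so \<open>conv_down\<close> is \<open>Z_down\<close> itself.\<close>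

lemma conv_down_first:
  fixes A :: "complex ^ 4"
  defines "e \<equiv> 1 - A $ 0"
  shows "conv_down (Asgn A (-1) (-1) (-1) (-1)) (Asgn A (-1) (-1) 1 1) (Asgn A (-1) 1 (-1) 1) (Asgn A (-1) 1 1 (-1)) m
     * ((e + m) * (e + m)) = Z_down A m * (e + m)\<^sup>2"
proof -
  have "Asgn A (-1) (-1) (-1) (-1) + Asgn A (-1) 1 (-1) 1 = 1 - A $ 0 - A $ 2"
    "Asgn A (-1) (-1) (-1) (-1) + Asgn A (-1) 1 1 (-1) = 1 - A $ 0 - A $ 3"
    "Asgn A (-1) (-1) 1 1 + Asgn A (-1) 1 (-1) 1 = 1 - A $ 0 + A $ 3"
    "Asgn A (-1) (-1) 1 1 + Asgn A (-1) 1 1 (-1) = 1 - A $ 0 + A $ 2"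
    by (simp_all add: Asgn_def field_simps)
  note lin = this
  show ?thesis
    unfolding conv_down_def lin Z_down_def e_def by algebra
qed

text \<open>Here two of the four sums equal \<open>e\<close> and the others are
  \<open>e - A $ 3\<close> and \<open>e + A $ 3\<close>. The missing factors with
  \<open>A $ 2\<close> come from \<open>p = e - A $ 2\<close> and
  \<open>q = e + A $ 2\<close>.\<close>

lemma conv_down_second:
  fixes A :: "complex ^ 4"
  defines "e \<equiv> 1 - A $ 0"
  shows "conv_down (Asgn A (-1) (-1) 1 (-1)) (Asgn A (-1) (-1) 1 1) (Asgn A (-1) 1 (-1) 1) (Asgn A (-1) 1 (-1) (-1)) m
     * ((e - A $ 2 + m) * (e + A $ 2 + m)) = Z_down A m * (e + m)\<^sup>2"
proof -
  have "Asgn A (-1) (-1) 1 (-1) + Asgn A (-1) 1 (-1) 1 = 1 - A $ 0"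
    "Asgn A (-1) (-1) 1 (-1) + Asgn A (-1) 1 (-1) (-1) = 1 - A $ 0 - A $ 3"
    "Asgn A (-1) (-1) 1 1 + Asgn A (-1) 1 (-1) 1 = 1 - A $ 0 + A $ 3"
    "Asgn A (-1) (-1) 1 1 + Asgn A (-1) 1 (-1) (-1) = 1 - A $ 0"
    by (simp_all add: Asgn_def field_simps)
  note lin = this
  show ?thesis
    unfolding conv_down_def lin Z_down_def e_def by algebra
qed

section \<open>Generic parameters\<close>

lemma algebraic_hypersurface_affine:
  fixes v :: "'n::finite \<Rightarrow> complex"
  assumes "v i \<noteq> 0"
  shows "algebraic_hypersurface {z. (\<Sum>j\<in>UNIV. v j * z $ j) + c = 0}"
proof -
  define unit :: "'n \<Rightarrow> 'n \<Rightarrow> nat" where "unit k = (\<lambda>j. if j = k then 1 else 0)" for k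
  \<comment> \<open>As \<open>unit\<close> is injective, the sum has at most one term; it equals
    \<open>v k\<close> at \<open>unit k\<close>.\<close>
  define w where "w m = (if m = (\<lambda>_. 0) then c else (\<Sum>k | m = unit k. v k))" for m
  have unit_eq: "unit k = unit l \<longleftrightarrow> k = l" and unit_nz: "unit k \<noteq> (\<lambda>_. 0)" for k l
    unfolding unit_def by (auto simp: fun_eq_iff split: if_splits)
  have w_unit: "w (unit k) = v k" for k
    using unit_nz by (simp add: w_def unit_eq)
  have mono: "(\<Prod>j\<in>UNIV. (z $ j) ^ unit k j) = z $ k" for z :: "complex ^ 'n" and k
  proof -
    have "(\<Prod>j\<in>UNIV. (z $ j) ^ unit k j) = (\<Prod>j\<in>UNIV. if j = k then z $ j else 1)"
      by (intro prod.cong) (auto simp: unit_def)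
    then show ?thesis by simp
  qed
  have "(\<Sum>m\<in>insert (\<lambda>_. 0) (range unit). w m * (\<Prod>j\<in>UNIV. (z $ j) ^ m j))
      = (\<Sum>j\<in>UNIV. v j * z $ j) + c" for z :: "complex ^ 'n"
  proof -
    have "inj unit" by (simp add: inj_def unit_eq)
    then have "(\<Sum>m\<in>range unit. w m * (\<Prod>j\<in>UNIV. (z $ j) ^ m j)) = (\<Sum>j\<in>UNIV. v j * z $ j)"
      by (simp add: sum.reindex w_unit mono)
    moreover have "(\<lambda>_. 0) \<notin> range unit" using unit_nz by (metis imageE)
    ultimately show ?thesis by (simp add: w_def)
  qed
  then have "{z. (\<Sum>j\<in>UNIV. v j * z $ j) + c = 0} =
      {z. (\<Sum>m\<in>insert (\<lambda>_. 0) (range unit). w m * (\<Prod>j\<in>UNIV. (z $ j) ^ m j)) = 0}"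
    by simp
  moreover have "finite (insert (\<lambda>_. 0) (range unit))" by simp
  moreover have "\<exists>m\<in>insert (\<lambda>_. 0) (range unit). m \<noteq> (\<lambda>_. 0) \<and> w m \<noteq> 0"
    using assms unit_nz w_unit by (intro bexI[of _ "unit i"]) auto
  ultimately show ?thesis
    unfolding algebraic_hypersurface_def by blast
qed

lemma holds_generically_affine:
  fixes v :: "'n::finite \<Rightarrow> complex"
  assumes "v i \<noteq> 0"
  shows "holds_generically (\<lambda>A. (\<Sum>j\<in>UNIV. v j * A $ j) + c \<noteq> 0)"
proof -
  define V where "V = {z :: complex ^ 'n. (\<Sum>j\<in>UNIV. v j * z $ j) + c = 0}"
  have "algebraic_hypersurface V"
    unfolding V_def by (rule algebraic_hypersurface_affine[where v=v and i=i, OF assms])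
  moreover have "(\<Sum>j\<in>UNIV. v j * A $ j) + c \<noteq> 0" if "A \<notin> V" for A
    using that unfolding V_def mem_Collect_eq .
  ultimately have "countable {V} \<and> (\<forall>W\<in>{V}. algebraic_hypersurface W) \<and>
      (\<forall>A. A \<notin> \<Union>{V} \<longrightarrow> (\<Sum>j\<in>UNIV. v j * A $ j) + c \<noteq> 0)"
    by blast
  then show ?thesis
    unfolding holds_generically_def by (rule exI)
qed

lemma holds_generically_mono:
  assumes "holds_generically P" "\<And>A. P A \<Longrightarrow> Q A"
  shows "holds_generically Q"
proof -
  obtain \<V> where "countable \<V>" "\<forall>V\<in>\<V>. algebraic_hypersurface V" "\<forall>A. A \<notin> \<Union>\<V> \<longrightarrow> P A"
    using assms(1) unfolding holds_generically_def by (elim exE conjE)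
  then show ?thesis
    unfolding holds_generically_def using assms(2) by (intro exI[of _ \<V>]) simp
qed

lemma holds_generically_all_countable:
  assumes "\<And>i :: 'i :: countable. holds_generically (P i)"
  shows "holds_generically (\<lambda>A. \<forall>i. P i A)"
proof -
  have "\<exists>\<V>. \<forall>i. countable (\<V> i) \<and> (\<forall>V\<in>\<V> i. algebraic_hypersurface V) \<and> (\<forall>A. A \<notin> \<Union>(\<V> i) \<longrightarrow> P i A)"
    using assms by (intro choice) (simp add: holds_generically_def)
  then obtain \<V> where V: "\<forall>i. countable (\<V> i) \<and> (\<forall>V\<in>\<V> i. algebraic_hypersurface V) \<and> (\<forall>A. A \<notin> \<Union>(\<V> i) \<longrightarrow> P i A)"
    by (rule exE)
  show ?thesis
    unfolding holds_generically_def
  proof (intro exI[of _ "\<Union>i. \<V> i"] conjI ballI allI impI)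
    show "countable (\<Union>i. \<V> i)" using V by blast
    show "algebraic_hypersurface V" if "V \<in> (\<Union>i. \<V> i)" for V using V that by blast
    show "P i A" if "A \<notin> \<Union>(\<Union>i. \<V> i)" for A i using V that by blast
  qed
qed

lemma holds_generically_conj:
  assumes "holds_generically P" "holds_generically Q"
  shows "holds_generically (\<lambda>A. P A \<and> Q A)"
proof -
  \<comment> \<open>A conjunction is a quantification over the countable type
    \<open>bool\<close>.\<close>
  have "holds_generically (\<lambda>A. \<forall>b. if b then P A else Q A)"
  proof (rule holds_generically_all_countable)
    show "holds_generically (\<lambda>A. if b then P A else Q A)" for b
      by (cases b) (use assms in simp_all)
  qed
  then show ?thesis by (rule holds_generically_mono) (metis (full_types, lifting))
qed

lemma holds_generically_affine4:
  assumes "a0 \<noteq> 0"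
  shows "holds_generically (\<lambda>A :: complex ^ 4. \<forall>i :: nat. a0 * A $ 0 + a1 * A $ 1 + a2 * A $ 2 + a3 * A $ 3 + c + of_nat i \<noteq> 0)"
proof (rule holds_generically_all_countable)
  fix i :: nat
  define v :: "4 \<Rightarrow> complex" where "v j = (if j = 0 then a0 else if j = 1 then a1 else if j = 2 then a2 else a3)" for j
  have "(\<Sum>j\<in>UNIV. v j * A $ j) = a0 * A $ 0 + a1 * A $ 1 + a2 * A $ 2 + a3 * A $ 3" for A :: "complex ^ 4"
  proof -
    \<comment> \<open>\<open>sum_4\<close> runs over the indices 1 to 4, and the index 4 is 0 modulo
      4.\<close>
    have four: "(4 :: 4) = 0" by simp
    show ?thesis unfolding sum_4 four by (simp add: v_def)
  qed
  then show "holds_generically (\<lambda>A :: complex ^ 4. a0 * A $ 0 + a1 * A $ 1 + a2 * A $ 2 + a3 * A $ 3 + c + of_nat i \<noteq> 0)"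
    using holds_generically_affine[of v 0 "c + of_nat i"] assms by (simp add: v_def add.assoc)
qed

text \<open>The first three forms keep the exponents at 0 away from the positive integers, make
  \<open>A $ 0\<close> nonzero and keep the lower Pochhammer symbols nonzero. The next two do this
  for the lower parameters of the second product. The \<open>Asgn\<close> forms are upper
  parameters: their Pochhammer symbols occur as denominators under reflection or in the ratio
  test.\<close>

definition nonresonant :: "complex ^ 4 \<Rightarrow> bool" where
  "nonresonant A \<longleftrightarrow> (\<forall>a\<in>{- A $ 0, 1/2 - A $ 0, 1 - 2 * A $ 0, 1 - A $ 0 - A $ 2, 1 - A $ 0 + A $ 2,
     Asgn A (-1) (-1) (-1) (-1), Asgn A (-1) (-1) 1 1, Asgn A (-1) (-1) 1 (-1),
     Asgn A (-1) 1 (-1) 1, Asgn A (-1) 1 1 (-1)}. \<forall>i :: nat. a + of_nat i \<noteq> 0)"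

lemma holds_generically_nonresonant: "holds_generically nonresonant"
proof -
  have "holds_generically (\<lambda>A :: complex ^ 4. \<forall>i :: nat. Asgn A (-1) e1 e2 e3 + of_nat i \<noteq> 0)" for e1 e2 e3
    using holds_generically_affine4[of "-1/2" "e1/2" "e2/2" "e3/2" "1/2"]
    by (rule holds_generically_mono) (simp_all add: Asgn_def add_divide_distrib diff_divide_distrib)
  note 1 = this
  have 2: "holds_generically (\<lambda>A :: complex ^ 4. \<forall>i :: nat. c - a0 * A $ 0 + a2 * A $ 2 + of_nat i \<noteq> 0)"
    if "a0 \<noteq> 0" for a0 a2 c
  proof (rule holds_generically_mono)
    show "holds_generically (\<lambda>A :: complex ^ 4. \<forall>i :: nat. - a0 * A $ 0 + 0 * A $ 1 + a2 * A $ 2 + 0 * A $ 3 + c + of_nat i \<noteq> 0)"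
      using that by (intro holds_generically_affine4) simp
  qed (simp add: algebra_simps)
  have "holds_generically (\<lambda>A. (\<forall>i :: nat. - A $ 0 + of_nat i \<noteq> 0) \<and> (\<forall>i :: nat. 1/2 - A $ 0 + of_nat i \<noteq> 0)
     \<and> (\<forall>i :: nat. 1 - 2 * A $ 0 + of_nat i \<noteq> 0) \<and> (\<forall>i :: nat. 1 - A $ 0 - A $ 2 + of_nat i \<noteq> 0)
     \<and> (\<forall>i :: nat. 1 - A $ 0 + A $ 2 + of_nat i \<noteq> 0)
     \<and> (\<forall>i :: nat. Asgn A (-1) (-1) (-1) (-1) + of_nat i \<noteq> 0)
     \<and> (\<forall>i :: nat. Asgn A (-1) (-1) 1 1 + of_nat i \<noteq> 0) \<and> (\<forall>i :: nat. Asgn A (-1) (-1) 1 (-1) + of_nat i \<noteq> 0)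
     \<and> (\<forall>i :: nat. Asgn A (-1) 1 (-1) 1 + of_nat i \<noteq> 0) \<and> (\<forall>i :: nat. Asgn A (-1) 1 1 (-1) + of_nat i \<noteq> 0))"
    using 2[of 1 0 0] 2[of 1 "1/2" 0] 2[of 2 1 0] 2[of 1 1 "-1"] 2[of 1 1 1]
    by (intro holds_generically_conj 1) simp_all
  then show ?thesis
    by (rule holds_generically_mono) (simp add: nonresonant_def)
qed

section \<open>The terminating sums as convolutions\<close>

definition hyp_coeff :: "complex \<Rightarrow> complex \<Rightarrow> complex \<Rightarrow> nat \<Rightarrow> complex" where
  "hyp_coeff a b c i = pochhammer a i * pochhammer b i / (fact i * pochhammer c i)"

lemma hyp_coeff_Suc:
  assumes "\<And>i. c + of_nat i \<noteq> 0"
  shows "of_nat (Suc i) * (c + of_nat i) * hyp_coeff a b c (Suc i) = (a + of_nat i) * (b + of_nat i) * hyp_coeff a b c i"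
proof -
  have "hyp_coeff a b c (Suc i) = ((a + of_nat i) * (b + of_nat i)) / (of_nat (Suc i) * (c + of_nat i)) * hyp_coeff a b c i"
    by (simp add: hyp_coeff_def pochhammer_Suc mult_ac)
  then show ?thesis using assms[of i] by (simp del: of_nat_Suc)
qed

lemma pochhammer_ne_0: "(\<And>i. a + of_nat i \<noteq> 0) \<Longrightarrow> pochhammer a n \<noteq> (0 :: complex)"
  by (metis add.left_inverse pochhammer_eq_0_iff)

text \<open>Reversing and negating the \<open>k\<close> factors gives the symbol of length
  \<open>k\<close> that starts at \<open>a + n - k\<close>, which completes
  \<open>pochhammer a (n - k)\<close> to \<open>pochhammer a n\<close>.\<close>

lemma pochhammer_reflect:
  fixes a :: complex
  assumes "k \<le> n"
  shows "pochhammer (1 - a - of_nat n) k * pochhammer a (n - k) = (-1) ^ k * pochhammer a n"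
proof -
  have "pochhammer (1 - a - of_nat n) k = (-1) ^ k * pochhammer (a + of_nat n - 1 - of_nat k + 1) k"
    using pochhammer_minus[of "a + of_nat n - 1" k] by (simp add: algebra_simps)
  also have "a + of_nat n - 1 - of_nat k + 1 = a + of_nat (n - k)"
    using assms by (simp add: of_nat_diff)
  finally show ?thesis
    using pochhammer_product'[of a "n - k" k] assms by simp
qed

lemma hypergeometric_terminating:
  "hypergeometric [- of_nat n, x, y, z] [r, s, t] 1 =
    (\<Sum>k\<le>n. pochhammer (- of_nat n) k * pochhammer x k * pochhammer y k * pochhammer z k
      / (pochhammer r k * pochhammer s k * pochhammer t k * fact k))"
proof -
  have "hypergeometric [- of_nat n, x, y, z] [r, s, t] 1 =
     (\<Sum>k. pochhammer (- of_nat n) k * pochhammer x k * pochhammer y k * pochhammer z k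
      / (pochhammer r k * pochhammer s k * pochhammer t k * fact k))"
    by (simp add: hypergeometric_def eval_fps_def)
  also have "\<dots> = (\<Sum>k\<le>n. pochhammer (- of_nat n) k * pochhammer x k * pochhammer y k * pochhammer z k
      / (pochhammer r k * pochhammer s k * pochhammer t k * fact k))"
    by (rule suminf_finite) (auto simp: pochhammer_of_nat_eq_0_lemma)
  finally show ?thesis .
qed

text \<open>Two upper and two lower symbols are reflected, so the signs cancel. The symbols of
  length \<open>n\<close> cancel against the prefactor except for \<open>pochhammer q n\<close>;
  those of length \<open>n - k\<close> and \<open>k\<close> form the two Gauss coefficients.\<close>

lemma weighted_conv_hyp_coeff:
  assumes "\<And>i. a + of_nat i \<noteq> 0" "\<And>i. b + of_nat i \<noteq> 0" "\<And>i. q + of_nat i \<noteq> 0"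
  shows "pochhammer a n * pochhammer b n / fact n *
      hypergeometric [- of_nat n, 1 - q - of_nat n, c, d] [1 - b - of_nat n, 1 - a - of_nat n, p] 1
    = pochhammer q n * weighted_conv (hyp_coeff a b q) (hyp_coeff c d p) (\<lambda>_. 1) n"
  unfolding weighted_conv_def hypergeometric_terminating sum_distrib_left
proof (rule sum.cong)
  fix k assume "k \<in> {..n}"
  then have k: "k \<le> n" by simp
  have nz: "pochhammer a m \<noteq> 0" "pochhammer b m \<noteq> 0" "pochhammer q m \<noteq> 0" for m
    using assms by (simp_all add: pochhammer_ne_0)
  note R = pochhammer_reflect[OF k]
  have ra: "pochhammer (1 - a - of_nat n) k = (-1) ^ k * pochhammer a n / pochhammer a (n - k)"
    and rb: "pochhammer (1 - b - of_nat n) k = (-1) ^ k * pochhammer b n / pochhammer b (n - k)"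
    and rq: "pochhammer (1 - q - of_nat n) k = (-1) ^ k * pochhammer q n / pochhammer q (n - k)"
    and r1: "pochhammer (- of_nat n) k = (-1) ^ k * fact n / (fact (n - k) :: complex)"
    using R[of a] R[of b] R[of q] R[of 1] nz by (simp_all add: eq_divide_eq pochhammer_fact[symmetric])
  show "pochhammer a n * pochhammer b n / fact n *
       (pochhammer (- of_nat n) k * pochhammer (1 - q - of_nat n) k * pochhammer c k * pochhammer d k /
        (pochhammer (1 - b - of_nat n) k * pochhammer (1 - a - of_nat n) k * pochhammer p k * fact k)) =
       pochhammer q n * (1 * (hyp_coeff a b q (n - k) * hyp_coeff c d p k))"
    unfolding ra rb rq r1 hyp_coeff_def using nz[of n] nz[of "n - k"] by (simp add: field_simps)
qed simp

text \<open>The case \<open>p = q = e\<close>. One factor \<open>pochhammer e n\<close> is left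
  uncancelled so that the shape fits \<open>Z_coeff_conv_eq_0\<close>.\<close>

lemma f00_coeff1_eq:
  fixes A :: "complex ^ 4"
  assumes "nonresonant A"
  defines "e \<equiv> 1 - A $ 0"
  shows "f00_coeff1 A n = pochhammer e n * pochhammer e n / (pochhammer e n * pochhammer (e + 1/2) n) *
    weighted_conv (hyp_coeff (Asgn A (-1) (-1) (-1) (-1)) (Asgn A (-1) (-1) 1 1) e)
      (hyp_coeff (Asgn A (-1) 1 (-1) 1) (Asgn A (-1) 1 1 (-1)) e) (\<lambda>_. 1) n"
proof -
  have e: "e + of_nat i \<noteq> 0" for i
  proof -
    have "- A $ 0 + of_nat (Suc i) \<noteq> 0" using assms(1) unfolding nonresonant_def by blast
    then show ?thesis by (simp add: e_def algebra_simps)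
  qed
  have ab: "\<And>i. Asgn A (-1) (-1) (-1) (-1) + of_nat i \<noteq> 0" "\<And>i. Asgn A (-1) (-1) 1 1 + of_nat i \<noteq> 0"
    using assms(1) by (simp_all add: nonresonant_def)
  have eq: "A $ 0 - of_nat n = 1 - e - of_nat n" "Asgn A 1 1 (-1) (-1) = 1 - Asgn A (-1) (-1) 1 1"
    "Asgn A 1 1 1 1 = 1 - Asgn A (-1) (-1) (-1) (-1)" "1 - A $ 0 = e" "3/2 - A $ 0 = e + 1/2"
    by (simp_all add: e_def Asgn_def field_simps)
  show ?thesis
    using weighted_conv_hyp_coeff[OF ab e, of n "Asgn A (-1) 1 (-1) 1" "Asgn A (-1) 1 1 (-1)" e] pochhammer_ne_0[of e n, OF e]
    unfolding f00_coeff1_def eq by (simp add: field_simps)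
qed

text \<open>The case \<open>p = e - A $ 2\<close>, \<open>q = e + A $ 2\<close>: the symbol of
  \<open>p\<close> stands in the prefactor of the sum, that of \<open>q\<close> comes from
  reflecting \<open>A $ 0 - A $ 2 - of_nat n\<close>.\<close>

lemma f00_coeff2_eq:
  fixes A :: "complex ^ 4"
  assumes "nonresonant A"
  defines "e \<equiv> 1 - A $ 0"
  shows "f00_coeff2 A n = pochhammer (e - A $ 2) n * pochhammer (e + A $ 2) n / (pochhammer e n * pochhammer (e + 1/2) n) *
    weighted_conv (hyp_coeff (Asgn A (-1) (-1) 1 (-1)) (Asgn A (-1) (-1) 1 1) (e + A $ 2))
      (hyp_coeff (Asgn A (-1) 1 (-1) 1) (Asgn A (-1) 1 (-1) (-1)) (e - A $ 2)) (\<lambda>_. 1) n"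
proof -
  have q: "e + A $ 2 + of_nat i \<noteq> 0" for i
    using assms(1) by (simp add: nonresonant_def e_def)
  have ab: "\<And>i. Asgn A (-1) (-1) 1 (-1) + of_nat i \<noteq> 0" "\<And>i. Asgn A (-1) (-1) 1 1 + of_nat i \<noteq> 0"
    using assms(1) by (simp_all add: nonresonant_def)
  have eq: "A $ 0 - A $ 2 - of_nat n = 1 - (e + A $ 2) - of_nat n" "Asgn A 1 1 (-1) (-1) = 1 - Asgn A (-1) (-1) 1 1"
    "Asgn A 1 1 (-1) 1 = 1 - Asgn A (-1) (-1) 1 (-1)" "1 - A $ 0 = e" "3/2 - A $ 0 = e + 1/2"
    by (simp_all add: e_def Asgn_def field_simps)
  show ?thesis
    using arg_cong[where f="\<lambda>x. pochhammer (e - A $ 2) n / (pochhammer e n * pochhammer (e + 1/2) n) * x",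
        OF weighted_conv_hyp_coeff[OF ab q, of n "Asgn A (-1) 1 (-1) 1" "Asgn A (-1) 1 (-1) (-1)" "e - A $ 2"]]
    unfolding f00_coeff2_def eq by (simp add: mult_ac)
qed

section \<open>Convergence\<close>

lemma ratio_shift_tendsto_1: "(\<lambda>n. (x + of_nat n) / (y + of_nat n)) \<longlonglongrightarrow> (1 :: complex)"
proof -
  have lim: "filterlim (\<lambda>n. y + of_nat n) at_infinity sequentially"
    by (intro tendsto_add_filterlim_at_infinity[OF tendsto_const] tendsto_of_nat)
  then have "(\<lambda>n. 1 + (x - y) / (y + of_nat n)) \<longlonglongrightarrow> 1 + 0"
    by (intro tendsto_add tendsto_const tendsto_divide_0[OF tendsto_const])
  moreover have "eventually (\<lambda>n. y + of_nat n \<noteq> 0) sequentially"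
    using filterlim_at_infinity_imp_eventually_ne[OF lim] .
  then have "eventually (\<lambda>n. 1 + (x - y) / (y + of_nat n) = (x + of_nat n) / (y + of_nat n)) sequentially"
    by eventually_elim (simp add: field_simps)
  ultimately show ?thesis
    using Lim_transform_eventually by fastforce
qed

lemma conv_radius_hyp_coeff:
  assumes "\<And>i. a + of_nat i \<noteq> 0" "\<And>i. b + of_nat i \<noteq> 0" "\<And>i. c + of_nat i \<noteq> 0"
  shows "conv_radius (hyp_coeff a b c) = 1"
proof (rule conv_radius_ratio_limit_nonzero[of _ 1])
  have "hyp_coeff a b c n / hyp_coeff a b c (Suc n) = (1 + of_nat n) / (a + of_nat n) * ((c + of_nat n) / (b + of_nat n))" for n
  proof -
    have "hyp_coeff a b c n \<noteq> 0"
      using assms by (simp add: hyp_coeff_def pochhammer_ne_0)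
    moreover have "hyp_coeff a b c (Suc n) = hyp_coeff a b c n * (((a + of_nat n) * (b + of_nat n)) / ((1 + of_nat n) * (c + of_nat n)))"
      by (simp add: hyp_coeff_def pochhammer_Suc mult_ac)
    ultimately show ?thesis by (simp add: mult_ac)
  qed
  moreover have "(\<lambda>n. norm ((1 + of_nat n) / (a + of_nat n) * ((c + of_nat n) / (b + of_nat n)))) \<longlonglongrightarrow> norm (1 * 1 :: complex)"
    by (intro tendsto_norm tendsto_mult ratio_shift_tendsto_1)
  ultimately show "(\<lambda>n. norm (hyp_coeff a b c n) / norm (hyp_coeff a b c (Suc n))) \<longlonglongrightarrow> 1"
    by (simp flip: norm_divide)
qed simp_all

lemma conv_radius_mult_eventually_bounded:
  fixes f g :: "nat \<Rightarrow> complex"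
  assumes "eventually (\<lambda>n. norm (g n) \<le> C) sequentially"
  shows "conv_radius (\<lambda>n. g n * f n) \<ge> conv_radius f"
proof (rule conv_radius_geI_ex')
  fix r :: real assume r: "0 < r" "ereal r < conv_radius f"
  then have "summable (\<lambda>n. C * norm (f n * of_real r ^ n))"
    by (intro summable_mult abs_summable_in_conv_radius) simp
  moreover from assms have "eventually (\<lambda>n. norm (g n * f n * of_real r ^ n) \<le> C * norm (f n * of_real r ^ n)) sequentially"
    by eventually_elim (simp add: norm_mult mult.assoc mult_right_mono)
  ultimately show "summable (\<lambda>n. g n * f n * of_real r ^ n)"
    by (rule summable_comparison_test_ev[rotated])
qed

text \<open>Once \<open>n \<ge> - Re e\<close>, moving \<open>e + n\<close> to the right by
  \<open>t\<close> does not decrease its modulus, so the moduli of the quotients decrease weakly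
  from there on.\<close>

lemma pochhammer_quotient_eventually_bounded:
  fixes e :: complex and t :: real
  assumes "\<And>i. e + of_real t + of_nat i \<noteq> 0" "t \<ge> 0"
  obtains C where "eventually (\<lambda>n. norm (pochhammer e n / pochhammer (e + of_real t) n) \<le> C) sequentially"
proof -
  define g where "g n = pochhammer e n / pochhammer (e + of_real t) n" for n
  obtain N :: nat where N: "real N \<ge> - Re e" using real_arch_simple by blast
  have "norm (g n) \<le> norm (g N)" if "n \<ge> N" for n
    using that
  proof (induction n rule: dec_induct)
    case (step n)
    have "cmod (e + of_nat n) \<le> cmod (e + of_real t + of_nat n)"
      unfolding cmod_def using step.hyps(1) N assms(2)
      by (intro real_sqrt_le_mono add_right_mono power_mono) auto
    then have "norm ((e + of_nat n) / (e + of_real t + of_nat n)) \<le> 1"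
      using assms(1)[of n] by (simp add: norm_divide divide_le_eq)
    then have "norm (g n) * norm ((e + of_nat n) / (e + of_real t + of_nat n)) \<le> norm (g n) * 1"
      by (intro mult_left_mono) auto
    moreover have "g (Suc n) = g n * ((e + of_nat n) / (e + of_real t + of_nat n))"
      by (simp add: g_def pochhammer_Suc)
    ultimately have "norm (g (Suc n)) \<le> norm (g n)" by (simp only: norm_mult mult_1_right)
    then show ?case using step.IH by (rule order_trans)
  qed simp
  then have "eventually (\<lambda>n. norm (g n) \<le> norm (g N)) sequentially"
    by (rule eventually_sequentiallyI)
  then show thesis unfolding g_def by (rule that)
qed

section \<open>Both coefficient sequences as solutions of the recurrence\<close>

lemma nonresonantD:
  assumes "nonresonant A"
  shows "1 - A $ 0 + of_nat i \<noteq> 0" "1 - A $ 0 + 1/2 + of_nat i \<noteq> 0" "A $ 0 \<noteq> 0" "Z_up A (of_nat i + 1) \<noteq> 0"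
proof -
  have 1: "- A $ 0 + of_nat j \<noteq> 0" "1/2 - A $ 0 + of_nat j \<noteq> 0" "1 - 2 * A $ 0 + of_nat j \<noteq> 0" for j
    using assms by (simp_all add: nonresonant_def)
  show "1 - A $ 0 + of_nat i \<noteq> 0" "1 - A $ 0 + 1/2 + of_nat i \<noteq> 0" "A $ 0 \<noteq> 0"
    using 1(1)[of "Suc i"] 1(1)[of 0] 1(2)[of "Suc i"] by (auto simp: algebra_simps)
  have "of_nat i + 1 - A $ 0 + 1/2 = 1/2 - A $ 0 + of_nat (Suc i)"
    "of_nat i + 1 - A $ 0 - 1/2 = 1/2 - A $ 0 + of_nat i"
    "of_nat i + 1 - 2 * A $ 0 = 1 - 2 * A $ 0 + of_nat i"
    "of_nat i + 1 = (of_nat (Suc i) :: complex)"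
    by (simp_all add: algebra_simps)
  then show "Z_up A (of_nat i + 1) \<noteq> 0"
    unfolding Z_up_def using 1(2)[of "Suc i"] 1(2)[of i] 1(3)[of i] by (simp only: mult_eq_0_iff of_nat_eq_0_iff) simp
qed

lemma Z_coeff_f00_coeff1:
  assumes "nonresonant A"
  shows "Z_coeff A (f00_coeff1 A) n = 0"
proof -
  define e where "e = 1 - A $ 0"
  have e: "e + of_nat i \<noteq> 0" "e + 1/2 + of_nat i \<noteq> 0" "A $ 0 \<noteq> 0" for i
    using nonresonantD[OF assms] unfolding e_def by blast+
  show ?thesis
    unfolding f00_coeff1_eq[OF assms, abs_def, folded e_def]
  proof (rule Z_coeff_conv_eq_0[where A=A, folded e_def])
    show "Asgn A (-1) (-1) (-1) (-1) + Asgn A (-1) (-1) 1 1 + Asgn A (-1) 1 (-1) 1 + Asgn A (-1) 1 1 (-1) = e + e"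
      by (simp add: e_def Asgn_def field_simps)
  qed (use e hyp_coeff_Suc[OF e(1)] conv_mid_first[of A, folded e_def] conv_down_first[of A, folded e_def] in simp_all)
qed

lemma Z_coeff_f00_coeff2:
  assumes "nonresonant A"
  shows "Z_coeff A (f00_coeff2 A) n = 0"
proof -
  define e where "e = 1 - A $ 0"
  have e: "e + of_nat i \<noteq> 0" "e + 1/2 + of_nat i \<noteq> 0" "A $ 0 \<noteq> 0" for i
    using nonresonantD[OF assms] unfolding e_def by blast+
  have pq: "e - A $ 2 + of_nat i \<noteq> 0" "e + A $ 2 + of_nat i \<noteq> 0" for i
    using assms by (simp_all add: nonresonant_def e_def)
  show ?thesis
    unfolding f00_coeff2_eq[OF assms, abs_def, folded e_def]
  proof (rule Z_coeff_conv_eq_0[where A=A, folded e_def])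
    show "Asgn A (-1) (-1) 1 (-1) + Asgn A (-1) (-1) 1 1 + Asgn A (-1) 1 (-1) 1 + Asgn A (-1) 1 (-1) (-1)
        = e - A $ 2 + (e + A $ 2)"
      by (simp add: e_def Asgn_def field_simps)
  qed (use e hyp_coeff_Suc[OF pq(1)] hyp_coeff_Suc[OF pq(2)] conv_mid_second[of A, folded e_def] conv_down_second[of A, folded e_def] in simp_all)
qed

lemma f00_coeff_0: "f00_coeff1 A 0 = 1" "f00_coeff2 A 0 = 1"
  by (simp_all add: f00_coeff1_def f00_coeff2_def hypergeometric_terminating[of 0, simplified])

text \<open>For \<open>p = q = e\<close> the factor reduces to a bounded Pochhammer quotient with
  \<open>t = 1/2\<close>, and the Cauchy product of two series of radius 1 has radius at least
  1.\<close>

lemma conv_radius_f00_coeff1: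
  assumes "nonresonant A"
  shows "conv_radius (f00_coeff1 A) \<ge> 1"
proof -
  define e where "e = 1 - A $ 0"
  have e: "e + of_nat i \<noteq> 0" "e + 1/2 + of_nat i \<noteq> 0" for i
    using nonresonantD[OF assms] unfolding e_def by blast+
  define u where "u = hyp_coeff (Asgn A (-1) (-1) (-1) (-1)) (Asgn A (-1) (-1) 1 1) e"
  define v where "v = hyp_coeff (Asgn A (-1) 1 (-1) 1) (Asgn A (-1) 1 1 (-1)) e"
  obtain C where C: "eventually (\<lambda>n. norm (pochhammer e n / pochhammer (e + of_real (1/2)) n) \<le> C) sequentially"
    using pochhammer_quotient_eventually_bounded[of e "1/2"] e(2) by auto
  have "conv_radius u = 1" "conv_radius v = 1"
    unfolding u_def v_def by (rule conv_radius_hyp_coeff; use assms e in \<open>simp add: nonresonant_def\<close>)+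
  then have "conv_radius (\<lambda>n. \<Sum>i\<le>n. v i * u (n - i)) \<ge> 1"
    using conv_radius_mult_ge[of v u] by simp
  also have "(\<lambda>n. \<Sum>i\<le>n. v i * u (n - i)) = weighted_conv u v (\<lambda>_. 1)"
    by (simp add: weighted_conv_def mult.commute fun_eq_iff)
  also note conv_radius_mult_eventually_bounded[OF C]
  also have "(\<lambda>n. pochhammer e n / pochhammer (e + of_real (1/2)) n * weighted_conv u v (\<lambda>_. 1) n) = f00_coeff1 A"
    using pochhammer_ne_0[OF e(1)]
    by (simp add: fun_eq_iff f00_coeff1_eq[OF assms] u_def v_def e_def[symmetric])
  finally show ?thesis .
qed

text \<open>The indicial polynomial has no positive integer root, so each equation can be solved for
  the coefficient of highest index.\<close>

lemma Z_coeff_unique: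
  assumes "nonresonant A" "\<And>n. Z_coeff A c n = 0" "\<And>n. Z_coeff A c' n = 0" "c 0 = c' 0"
  shows "c n = c' n"
proof (induction n rule: less_induct)
  case (less n)
  show ?case
  proof (cases n)
    case (Suc m)
    \<comment> \<open>For \<open>m = 0\<close> the truncated \<open>m - 1\<close> is 0, which the
      induction hypothesis also covers.\<close>
    have eq: "c m = c' m" "c (m - 1) = c' (m - 1)"
      using less.IH Suc by simp_all
    have "Z_up A (of_nat m + 1) * (c (Suc m) - c' (Suc m)) = Z_coeff A c m - Z_coeff A c' m"
      unfolding Z_coeff_def eq by (simp add: algebra_simps)
    also have "\<dots> = 0" using assms(2,3) by simp
    finally have "Z_up A (of_nat m + 1) * (c (Suc m) - c' (Suc m)) = 0" .
    then show ?thesis using nonresonantD(4)[OF assms(1), of m] Suc by simp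
  qed (use assms in simp)
qed

section \<open>Holomorphic solutions\<close>

text \<open>In terms of the Euler operator \<open>\<theta> = x d/dx\<close>, this is \<open>x^j
  (d/dx)^j = \<theta> (\<theta> - 1) ... (\<theta> - j + 1)\<close>, which is diagonal on
  monomials.\<close>

lemma fps_nth_X_power_deriv:
  "fps_nth (fps_X ^ j * (fps_deriv ^^ j) F) n = (\<Prod>i<j. of_nat n - of_nat i) * fps_nth (F :: complex fps) n"
proof (induction j)
  case (Suc j)
  define P where "P = fps_X ^ j * (fps_deriv ^^ j) F"
  have power: "fps_X * fps_deriv (fps_X ^ j) = of_nat j * (fps_X ^ j :: complex fps)"
    by (induction j) (simp_all add: algebra_simps)
  have "fps_X * fps_deriv P =
      (fps_X * fps_deriv (fps_X ^ j)) * (fps_deriv ^^ j) F + fps_X * fps_X ^ j * fps_deriv ((fps_deriv ^^ j) F)"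
    unfolding P_def fps_deriv_mult by (simp only: algebra_simps)
  then have "fps_X * fps_deriv P = of_nat j * P + fps_X ^ Suc j * (fps_deriv ^^ Suc j) F"
    unfolding power P_def by (simp only: mult.assoc power_Suc funpow.simps o_apply)
  then have "fps_X ^ Suc j * (fps_deriv ^^ Suc j) F = fps_X * fps_deriv P - fps_const (of_nat j) * P"
    by (metis add_diff_cancel_left' fps_of_nat)
  moreover have "fps_nth (fps_X * fps_deriv P) n = of_nat n * fps_nth P n"
    by (cases n) simp_all
  ultimately have "fps_nth (fps_X ^ Suc j * (fps_deriv ^^ Suc j) F) n = (of_nat n - of_nat j) * fps_nth P n"
    by (simp only: fps_sub_nth fps_mult_left_const_nth left_diff_distrib)
  then show ?case
    using Suc.IH by (simp add: P_def)
qed simp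

text \<open>The terms are sorted by how they shift the degree of a monomial. Those lowering it by 1
  are written through \<open>deriv f\<close>, which avoids a division by \<open>x\<close>.\<close>

lemma Zop_euler:
  "Zop A f x =
     (let A0 = A $ 0; A1 = A $ 1; A2 = A $ 2; A3 = A $ 3; g = deriv f; \<theta> = (\<lambda>h j. x ^ j * (deriv ^^ j) h x) in
     \<theta> g 3 + (6 - 4 * A0) * \<theta> g 2 + (1/4 * (10*A0 - 9) * (2*A0 - 3)) * \<theta> g 1 + (- 1/4 * (2*A0 - 3) * (2*A0 - 1)^2) * \<theta> g 0
     + ((- 2) * \<theta> f 4 + (8 * A0 - 16) * \<theta> f 3
     + (- 11*A0^2 - A1^2 + A2^2 + A3^2 + 36*A0 - 59/2) * \<theta> f 2
     + ((A0 - 1) * (6*A0^2 + 2*A1^2 - 2*A2^2 - 2*A3^2 - 16*A0 + 11)) * \<theta> f 1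
     + (- 1/4 * (2*A0 - 1)^2 * (A0^2 + A1^2 - A2^2 - A3^2 - 2*A0 + 1)) * \<theta> f 0)
     + x * (\<theta> f 4 + (10 - 4 * A0) * \<theta> f 3 + (6*A0^2 - A2^2 - A3^2 - 24*A0 + 25) * \<theta> f 2
        + (- (2*A0 - 3) * (2*A0^2 - A2^2 - A3^2 - 6*A0 + 5)) * \<theta> f 1
        + ((A0 - 1 + A3) * (A0 - 1 - A3) * (A0 - 1 + A2) * (A0 - 1 - A2)) * \<theta> f 0))"
proof -
  have "(deriv ^^ 3) (deriv f) x = (deriv ^^ 4) f x" "(deriv ^^ 2) (deriv f) x = (deriv ^^ 3) f x"
    by (simp_all add: eval_nat_numeral)
  note 1 = this
  define D4 D3 D2 D1 D0 where "D4 = (deriv ^^ 4) f x" and "D3 = (deriv ^^ 3) f x"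
    and "D2 = (deriv ^^ 2) f x" and "D1 = deriv f x" and "D0 = f x"
  have 2: "(deriv ^^ 1) (deriv f) x = D2" "(deriv ^^ 0) (deriv f) x = D1" "(deriv ^^ 1) f x = D1" "(deriv ^^ 0) f x = D0"
    by (simp_all add: D2_def D1_def D0_def eval_nat_numeral)
  show ?thesis
    unfolding Zop_def Let_def 1 2 D4_def[symmetric] D3_def[symmetric] D2_def[symmetric] D1_def[symmetric] D0_def[symmetric]
    by (simp add: field_simps power2_eq_square power3_eq_cube power4_eq_xxxx)
qed

lemma has_fps_expansion_higher_deriv:
  "f has_fps_expansion F \<Longrightarrow> (deriv ^^ j) f has_fps_expansion (fps_deriv ^^ j) (F :: complex fps)"
  by (induction j) (auto intro: has_fps_expansion_deriv)

text \<open>Each group of the Euler form acts diagonally; the derivative in the first and the factor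
  \<open>x\<close> in the last supply the index shifts. Near 0, the differential equation thus
  becomes the three-term recurrence.\<close>

lemma Zop_has_fps_expansion:
  assumes "f has_fps_expansion F"
  shows "Zop A f has_fps_expansion Abs_fps (Z_coeff A (fps_nth F))"
proof -
  define E where "E j G = fps_X ^ j * (fps_deriv ^^ j) G" for j and G :: "complex fps"
  have E: "(\<lambda>x. x ^ j * (deriv ^^ j) h x) has_fps_expansion E j H" if "h has_fps_expansion H" for h H j
    unfolding E_def using has_fps_expansion_higher_deriv[OF that] by (intro fps_expansion_intros)
  define A0 A1 A2 A3 where "A0 = A $ 0" and "A1 = A $ 1" and "A2 = A $ 2" and "A3 = A $ 3"
  define u2 u1 u0 where "u2 = 6 - 4 * A0" and "u1 = 1/4 * (10*A0 - 9) * (2*A0 - 3)"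
    and "u0 = - 1/4 * (2*A0 - 3) * (2*A0 - 1)^2"
  define m3 m2 m1 m0 where "m3 = 8 * A0 - 16" and "m2 = - 11*A0^2 - A1^2 + A2^2 + A3^2 + 36*A0 - 59/2"
    and "m1 = (A0 - 1) * (6*A0^2 + 2*A1^2 - 2*A2^2 - 2*A3^2 - 16*A0 + 11)"
    and "m0 = - 1/4 * (2*A0 - 1)^2 * (A0^2 + A1^2 - A2^2 - A3^2 - 2*A0 + 1)"
  define d3 d2 d1 d0 where "d3 = 10 - 4 * A0" and "d2 = 6*A0^2 - A2^2 - A3^2 - 24*A0 + 25"
    and "d1 = - (2*A0 - 3) * (2*A0^2 - A2^2 - A3^2 - 6*A0 + 5)"
    and "d0 = (A0 - 1 + A3) * (A0 - 1 - A3) * (A0 - 1 + A2) * (A0 - 1 - A2)"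
  note coeff_defs = u2_def u1_def u0_def m3_def m2_def m1_def m0_def d3_def d2_def d1_def d0_def
    A0_def A1_def A2_def A3_def
  define H where "H =
       E 3 (fps_deriv F) + fps_const u2 * E 2 (fps_deriv F) + fps_const u1 * E 1 (fps_deriv F)
       + fps_const u0 * E 0 (fps_deriv F)
     + (fps_const (- 2) * E 4 F + fps_const m3 * E 3 F + fps_const m2 * E 2 F + fps_const m1 * E 1 F
       + fps_const m0 * E 0 F)
     + fps_X * (E 4 F + fps_const d3 * E 3 F + fps_const d2 * E 2 F + fps_const d1 * E 1 F + fps_const d0 * E 0 F)"
  have "Zop A f has_fps_expansion H"
    unfolding Zop_euler[abs_def] Let_def H_def coeff_defs
    by (intro has_fps_expansion_add has_fps_expansion_cmult_left has_fps_expansion_mult[OF has_fps_expansion_fps_X]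
         E assms has_fps_expansion_deriv)
  moreover have "H = Abs_fps (Z_coeff A (fps_nth F))"
  proof (rule fps_ext)
    fix n :: nat
    have En: "fps_nth (E 0 G) n = fps_nth G n" "fps_nth (E 1 G) n = of_nat n * fps_nth G n"
      "fps_nth (E 2 G) n = (of_nat n * (of_nat n - 1)) * fps_nth G n"
      "fps_nth (E 3 G) n = (of_nat n * (of_nat n - 1) * (of_nat n - 2)) * fps_nth G n"
      "fps_nth (E 4 G) n = (of_nat n * (of_nat n - 1) * (of_nat n - 2) * (of_nat n - 3)) * fps_nth G n" for G n
      unfolding E_def fps_nth_X_power_deriv by (simp_all add: eval_nat_numeral)
    have X: "fps_nth (fps_X * G) n = (if n = 0 then 0 else fps_nth G (n - 1))" for G :: "complex fps"
      by simp
    \<comment> \<open>The factor \<open>\<nu> + 1\<close> comes from the coefficients of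
      \<open>fps_deriv F\<close>; with it the cubic becomes the indicial polynomial at
      \<open>\<nu> + 1\<close>.\<close>
    have up: "(\<nu> * (\<nu> - 1) * (\<nu> - 2) + u2 * (\<nu> * (\<nu> - 1)) + u1 * \<nu> + u0) * (\<nu> + 1) = Z_up A (\<nu> + 1)" for \<nu>
      by (simp add: Z_up_def u2_def u1_def u0_def A0_def[symmetric] field_simps power2_eq_square)
    have mid: "Z_mid A \<nu> = - 2 * (\<nu> * (\<nu> - 1) * (\<nu> - 2) * (\<nu> - 3)) + m3 * (\<nu> * (\<nu> - 1) * (\<nu> - 2))
        + m2 * (\<nu> * (\<nu> - 1)) + m1 * \<nu> + m0" for \<nu>
      by (simp add: Z_mid_def Let_def coeff_defs)
    have down: "\<nu> * (\<nu> - 1) * (\<nu> - 2) * (\<nu> - 3) + d3 * (\<nu> * (\<nu> - 1) * (\<nu> - 2)) + d2 * (\<nu> * (\<nu> - 1))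
        + d1 * \<nu> + d0 = Z_down A \<nu>" for \<nu>
      unfolding Z_down_def coeff_defs by algebra
    show "fps_nth H n = fps_nth (Abs_fps (Z_coeff A (fps_nth F))) n"
      unfolding H_def fps_add_nth fps_mult_left_const_nth X En fps_nth_Abs_fps Z_coeff_def
        up[symmetric] mid down[symmetric] fps_deriv_nth
      by (cases n) (simp_all add: algebra_simps)
  qed
  ultimately show ?thesis by simp
qed

lemma Zop_holomorphic:
  assumes "f holomorphic_on S" "open S"
  shows "Zop A f holomorphic_on S"
  unfolding Zop_def[abs_def] Let_def by (intro holomorphic_intros assms)

lemma normalized_solution_fps_expansion:
  assumes "normalized_solution A r f" "0 < r"
  shows "f has_fps_expansion fps_expansion f 0" "fps_nth (fps_expansion f 0) 0 = 1"
    "Z_coeff A (fps_nth (fps_expansion f 0)) n = 0"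
proof -
  have f: "f holomorphic_on ball 0 r" "\<forall>x\<in>ball 0 r. Zop A f x = 0" "f 0 = 1"
    using assms(1) by (auto simp: normalized_solution_def)
  show F: "f has_fps_expansion fps_expansion f 0"
    using has_fps_expansion_fps_expansion[of "ball 0 r" f] f assms(2) by simp
  show "fps_nth (fps_expansion f 0) 0 = 1"
    using f by (simp add: fps_expansion_def)
  have "eventually (\<lambda>x. x \<in> ball 0 r) (nhds 0)"
    using assms(2) by (intro eventually_nhds_in_open) auto
  then have "eventually (\<lambda>x. Zop A f x = 0) (nhds 0)"
    by eventually_elim (use f in simp)
  then have "Zop A f has_fps_expansion 0"
    by (simp add: has_fps_expansion_0_iff)
  then have "Abs_fps (Z_coeff A (fps_nth (fps_expansion f 0))) = 0"
    using fps_expansion_unique_complex Zop_has_fps_expansion[OF F] by blast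
  then show "Z_coeff A (fps_nth (fps_expansion f 0)) n = 0"
    by (metis fps_nth_Abs_fps fps_zero_nth)
qed

text \<open>Both Taylor series solve the recurrence with initial value 1 and hence coincide; the
  identity theorem carries the equality from a neighbourhood of 0 to the smaller disc.\<close>

lemma normalized_solution_unique:
  assumes "nonresonant A" "normalized_solution A r f" "normalized_solution A s g" "0 < r" "0 < s"
    and x: "x \<in> ball 0 (min r s)"
  shows "f x = g x"
proof -
  note F = normalized_solution_fps_expansion[OF assms(2,4)]
  note G = normalized_solution_fps_expansion[OF assms(3,5)]
  have "fps_expansion f 0 = fps_expansion g 0"
    by (rule fps_ext, rule Z_coeff_unique[OF assms(1)]) (use F G in auto)
  then have "(\<lambda>x. f x - g x) has_fps_expansion 0"
    using has_fps_expansion_diff[OF F(1) G(1)] by simp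
  moreover have "(\<lambda>x. f x - g x) holomorphic_on ball 0 (min r s)"
    using assms(2,3) unfolding normalized_solution_def
    by (intro holomorphic_on_diff) (auto elim!: holomorphic_on_subset)
  ultimately have "f x - g x = 0"
    by (rule has_fps_expansion_0_analytic_continuation) (use x assms(4,5) in auto)
  then show ?thesis by simp
qed

lemma normalized_solution_exists:
  assumes "nonresonant A"
  defines "f \<equiv> (\<lambda>x. if x \<in> ball 0 1 then eval_fps (Abs_fps (f00_coeff1 A)) x else 0)"
  shows "normalized_solution A 1 f"
proof -
  define F where "F = Abs_fps (f00_coeff1 A)"
  have rad: "fps_conv_radius F \<ge> 1"
    using conv_radius_f00_coeff1[OF assms(1)] by (simp add: F_def fps_conv_radius_def)
  have "eval_fps F holomorphic_on ball 0 1"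
    using rad by (intro holomorphic_on_eval_fps) (auto simp: ball_eball_mono one_ereal_def)
  then have hol: "f holomorphic_on ball 0 1"
    by (rule holomorphic_transform) (simp add: f_def F_def)
  have "eventually (\<lambda>x. x \<in> ball 0 1) (nhds (0 :: complex))"
    by (intro eventually_nhds_in_open) auto
  then have "eventually (\<lambda>x. eval_fps F x = f x) (nhds 0)"
    by eventually_elim (simp add: f_def F_def)
  moreover have "fps_conv_radius F > 0" using rad by (rule less_le_trans[rotated]) simp
  ultimately have "f has_fps_expansion F"
    by (simp add: has_fps_expansion_def)
  then have "Zop A f has_fps_expansion Abs_fps (Z_coeff A (fps_nth F))"
    by (rule Zop_has_fps_expansion)
  also have "fps_nth F = f00_coeff1 A" by (simp add: F_def fun_eq_iff)
  also have "Abs_fps (Z_coeff A (f00_coeff1 A)) = 0"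
    using Z_coeff_f00_coeff1[OF assms(1)] by (simp add: fps_eq_iff)
  finally have "Zop A f has_fps_expansion 0" .
  \<comment> \<open>The recurrence only shows that \<open>Zop A f\<close> vanishes near 0; being
    holomorphic, it vanishes on the whole disc.\<close>
  then have "Zop A f x = 0" if "x \<in> ball 0 1" for x
    by (rule has_fps_expansion_0_analytic_continuation[where A="ball 0 1"])
       (use that Zop_holomorphic[OF hol] in auto)
  moreover have "f 0 = 1"
    by (simp add: f_def eval_fps_at_0 f00_coeff_0)
  ultimately show ?thesis
    using hol by (simp add: normalized_solution_def)
qed

section \<open>The function \<open>f00\<close>, its expansion and its symmetries\<close>

lemma f00_eq:
  assumes "nonresonant A"
  shows "f00 A = (\<lambda>x. if x \<in> ball 0 1 then eval_fps (Abs_fps (f00_coeff1 A)) x else 0)"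
  unfolding f00_def
proof (rule the_equality)
  show "normalized_solution A 1 (\<lambda>x. if x \<in> ball 0 1 then eval_fps (Abs_fps (f00_coeff1 A)) x else 0) \<and>
    (\<forall>x. x \<notin> ball 0 1 \<longrightarrow> (if x \<in> ball 0 1 then eval_fps (Abs_fps (f00_coeff1 A)) x else 0) = 0)"
    using normalized_solution_exists[OF assms] by simp
next
  fix f assume f: "normalized_solution A 1 f \<and> (\<forall>x. x \<notin> ball 0 1 \<longrightarrow> f x = 0)"
  show "f = (\<lambda>x. if x \<in> ball 0 1 then eval_fps (Abs_fps (f00_coeff1 A)) x else 0)"
  proof
    fix x
    show "f x = (if x \<in> ball 0 1 then eval_fps (Abs_fps (f00_coeff1 A)) x else 0)"
      using normalized_solution_unique[OF assms _ normalized_solution_exists[OF assms], of 1 f x] f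
      by (cases "x \<in> ball 0 1") auto
  qed
qed

lemma f00_coeff1_sums:
  assumes "nonresonant A" "x \<in> ball 0 1"
  shows "(\<lambda>n. x ^ n * f00_coeff1 A n) sums f00 A x"
proof -
  have "ereal (norm x) < fps_conv_radius (Abs_fps (f00_coeff1 A))"
  proof (rule less_le_trans)
    show "ereal (norm x) < 1" using assms(2) by (simp add: one_ereal_def)
    show "1 \<le> fps_conv_radius (Abs_fps (f00_coeff1 A))"
      using conv_radius_f00_coeff1[OF assms(1)] by (simp add: fps_conv_radius_def)
  qed
  from sums_eval_fps[OF this] show ?thesis
    using assms(2) by (simp add: f00_eq[OF assms(1)] mult.commute)
qed

text \<open>\<open>f00 A\<close> depends on \<open>A\<close> only through the operator, so a change
  of parameters that fixes the operator fixes the solution.\<close>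

lemma f00_cong: "(\<And>f x. Zop A f x = Zop B f x) \<Longrightarrow> f00 A = f00 B"
  by (simp add: f00_def normalized_solution_def)

lemma f00_negate: "j \<in> {1, 2, 3} \<Longrightarrow> f00 (negate_component j A) = f00 A"
  by (rule f00_cong) (auto simp: Zop_def negate_component_def Let_def algebra_simps)

lemma f00_swap: "f00 (swap23 A) = f00 A"
  by (rule f00_cong) (simp add: Zop_def swap23_def Let_def algebra_simps)

theorem theorem10p10:
  shows "holds_generically (\<lambda>A :: complex ^ 4.
    normalized_solution A 1 (f00 A) \<and>
    (\<forall>r g. 0 < r \<longrightarrow> normalized_solution A r g \<longrightarrow>
       (\<forall>x\<in>ball 0 (min r 1). g x = f00 A x)) \<and>
    (\<forall>x\<in>ball 0 1. (\<lambda>n. x ^ n * f00_coeff1 A n) sums f00 A x) \<and>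
    (\<forall>x\<in>ball 0 1. (\<lambda>n. x ^ n * f00_coeff2 A n) sums f00 A x) \<and>
    (\<forall>j\<in>{1, 2, 3}. \<forall>x\<in>ball 0 1. f00 (negate_component j A) x = f00 A x) \<and>
    (\<forall>x\<in>ball 0 1. f00 (swap23 A) x = f00 A x))"
proof (rule holds_generically_mono[OF holds_generically_nonresonant], intro conjI allI impI ballI)
  fix A :: "complex ^ 4" assume A: "nonresonant A"
  show sol: "normalized_solution A 1 (f00 A)"
    unfolding f00_eq[OF A] by (rule normalized_solution_exists[OF A])
  show "g x = f00 A x" if "0 < r" "normalized_solution A r g" "x \<in> ball 0 (min r 1)" for r g x
    using normalized_solution_unique[OF A that(2) sol that(1) _ that(3)] by simp
  show sums1: "(\<lambda>n. x ^ n * f00_coeff1 A n) sums f00 A x" if "x \<in> ball 0 1" for x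
    using f00_coeff1_sums[OF A that] .
  \<comment> \<open>Both sequences solve the recurrence of \<open>Z(A)\<close> and start with 1, so
    the second sum inherits its convergence and its value from the first.\<close>
  have "f00_coeff2 A = f00_coeff1 A"
    using Z_coeff_unique[OF A, of "f00_coeff2 A" "f00_coeff1 A"] Z_coeff_f00_coeff1[OF A] Z_coeff_f00_coeff2[OF A]
    by (auto simp: f00_coeff_0)
  then show "(\<lambda>n. x ^ n * f00_coeff2 A n) sums f00 A x" if "x \<in> ball 0 1" for x
    using sums1[OF that] by simp
  show "f00 (negate_component j A) x = f00 A x" if "j \<in> {1, 2, 3}" for j x
    using f00_negate[OF that] by simp
  show "f00 (swap23 A) x = f00 A x" for x
    by (simp add: f00_swap)
qed

end
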